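(* For positive integers $n$ and $h$, there is an optimal tree $T$ with $n$ vertices and height at most $h$ such that, denoting by $T_1,\dots,T_r$ the subtrees rooted at the children of the root, each $T_i$ is a $k_i$-split with $k_1\ge k_2\ge\dots\ge k_r$. Further, the tuple $(k_1,k_2,\dots,k_r)$ is described by one of the following three types: (i) (Paths) $k_r=0$, $k_{r-1}\in\{0,1\}$, $k_{r-2}=\dots=k_1=1$. (ii) (One large) $k_1>\left\lceil\sqrt{h+\frac54}-\frac12\right\rceil$ and $k_i=\left\lfloor\frac{h+1}{k_1+1}\right\rfloor$ for each $i\in\{2,\dots,r\}$ provided $\left\lfloor\frac{h+1}{k_1+1}\right\rfloor\ge\frac{h+1}{k_1}-1$. Further, if $n>5h^2$, then $k_i\le\ln(6h)$ for each $i\in\{2,\dots,r\}$. (iii) (Even distribution) $k_1\le\left\lceil\sqrt{h+\frac54}-\frac12\right\rceil$ and $|k_i-k_j|\le1$ for all $i,j\in\{1,\dots,r\}$. Further, if $n>5h^2$, then $k_i\le\ln(6h)$ for each $i\in\{2,\dots,r\}$.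
   Context: The height of a rooted tree is the maximum distance from the root to a vertex. A subtree of a tree is a connected subgraph induced on a nonempty set of vertices. For given positive integers $n,h$, a rooted tree with $n$ vertices and height at most $h$ is called optimal if it has the minimum number of subtrees containing the root among all rooted trees with $n$ vertices and height at most $h$. If $v_1,\dots,v_r$ are the neighbors (children) of the root of $T$, then $T_i$ is the subtree induced by $v_i$ and all its descendants, viewed as rooted at $v_i$. For $f\in\{0,1,\dots,h-1\}$, the $f$-split is the tree rooted at $w_1$ with $h+f$ vertices constructed from paths $(w_1,\dots,w_h)$ and $(u_1,\dots,u_f)$ by adding the edge $u_1w_{h-f}$ (for $f=0$ it is the path $(w_1,\dots,w_h)$ rooted at $w_1$).
   Formalization: Assumes n > h: for 2 ≤ n ≤ h each branch has fewer than h vertices, so none is a split, and for n = 1 there is no k_1. In (ii) the "provided" inequality is part of the claim whenever r ≥ 2 and is not required when r = 1. *)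

theory Defs
  imports Complex_Main "Graph_Theory.Graph_Theory"
begin

text \<open>
  Finite simple graphs are the symmetric loop-free pair digraphs of \<^locale>\<open>pair_graph\<close>; an
  undirected edge is a pair of opposite arcs. The library predicate \<^const>\<open>tree\<close> is not usable
  for them: its acyclicity also forbids the closed walk going along an edge and back. Hence only
  cycles of length at least three are excluded here.
\<close>

definition is_tree :: "'a pair_pre_digraph \<Rightarrow> bool" where
  "is_tree G \<longleftrightarrow> pair_graph G \<and> connected (with_proj G) \<and>
    \<not> (\<exists>p. pre_digraph.cycle (with_proj G) p \<and> length p \<ge> 3)"

definition rooted_tree :: "'a pair_pre_digraph \<Rightarrow> 'a \<Rightarrow> bool" where
  "rooted_tree G r \<longleftrightarrow> is_tree G \<and> r \<in> pverts G"

text \<open>The distance is the library's shortest-path length with unit arc weights.\<close>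

definition tree_height :: "'a pair_pre_digraph \<Rightarrow> 'a \<Rightarrow> ereal" where
  "tree_height G r = (MAX v \<in> pverts G. wf_digraph.\<mu> (with_proj G) (\<lambda>_. 1) r v)"

definition subtrees :: "'a pair_pre_digraph \<Rightarrow> ('a, 'a \<times> 'a) pre_digraph set" where
  "subtrees G = {H. induced_subgraph H (with_proj G) \<and> verts H \<noteq> {} \<and> connected H}"

definition num_root_subtrees :: "'a pair_pre_digraph \<Rightarrow> 'a \<Rightarrow> nat" where
  "num_root_subtrees G r = card {H \<in> subtrees G. r \<in> verts H}"

definition admissible :: "nat \<Rightarrow> nat \<Rightarrow> 'a pair_pre_digraph \<Rightarrow> 'a \<Rightarrow> bool" where
  "admissible n h G r \<longleftrightarrow> rooted_tree G r \<and> card (pverts G) = n \<and> tree_height G r \<le> ereal (real h)"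

text \<open>
  Every finite rooted tree is isomorphic to one whose vertices are natural numbers, so minimising
  over the latter is minimising over all rooted trees.
\<close>

definition optimal :: "nat \<Rightarrow> nat \<Rightarrow> nat pair_pre_digraph \<Rightarrow> nat \<Rightarrow> bool" where
  "optimal n h G r \<longleftrightarrow> admissible n h G r \<and>
    (\<forall>(G' :: nat pair_pre_digraph) r'. admissible n h G' r' \<longrightarrow> num_root_subtrees G r \<le> num_root_subtrees G' r')"

definition children :: "'a pair_pre_digraph \<Rightarrow> 'a \<Rightarrow> 'a set" where
  "children G r = {v. (r, v) \<in> parcs G}"

text \<open>
  The vertex \<open>v\<close> together with its descendants: the vertices \<open>w\<close> for which \<open>v\<close> lies on the path
  from the root \<open>r\<close> to \<open>w\<close>.
\<close>

definition descendants :: "'a pair_pre_digraph \<Rightarrow> 'a \<Rightarrow> 'a \<Rightarrow> 'a set" where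
  "descendants G r v = {w. \<exists>p. vpath p (with_proj G) \<and> hd p = r \<and> last p = w \<and> v \<in> set p}"

definition branch :: "'a pair_pre_digraph \<Rightarrow> 'a \<Rightarrow> 'a \<Rightarrow> ('a, 'a \<times> 'a) pre_digraph" where
  "branch G r v = with_proj G \<restriction> descendants G r v"

definition rooted_iso ::
  "('a, 'b) pre_digraph \<Rightarrow> 'a \<Rightarrow> ('c, 'd) pre_digraph \<Rightarrow> 'c \<Rightarrow> bool" where
  "rooted_iso G r H s \<longleftrightarrow>
    (\<exists>\<phi>. pre_digraph.digraph_isomorphism G \<phi> \<and> H = app_iso \<phi> G \<and> iso_verts \<phi> r = s)"

text \<open>
  The \<open>f\<close>-split, for \<open>f < h\<close>: the vertex \<open>w\<^sub>i\<close> is the number \<open>i\<close> (so the root \<open>w\<^sub>1\<close> is \<open>1\<close>) and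
  \<open>u\<^sub>i\<close> is \<open>h + i\<close>.
\<close>

definition split_edges :: "nat \<Rightarrow> nat \<Rightarrow> (nat \<times> nat) set" where
  "split_edges h f =
    {(i, i + 1) |i. 1 \<le> i \<and> i < h} \<union>
    {(h + i, h + (i + 1)) |i. 1 \<le> i \<and> i < f} \<union>
    (if f = 0 then {} else {(h + 1, h - f)})"

definition split_graph :: "nat \<Rightarrow> nat \<Rightarrow> nat pair_pre_digraph" where
  "split_graph h f =
    \<lparr> pverts = {1..h + f}, parcs = split_edges h f \<union> (split_edges h f)\<inverse> \<rparr>"

definition is_split :: "nat \<Rightarrow> nat \<Rightarrow> ('a, 'b) pre_digraph \<Rightarrow> 'a \<Rightarrow> bool" where
  "is_split h f G r \<longleftrightarrow> f < h \<and> rooted_iso G r (with_proj (split_graph h f)) 1"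

text \<open>
  In the following, a tuple \<open>(k\<^sub>1, \<dots>, k\<^sub>r)\<close> is given by its length \<open>r\<close> and a function of which only
  the values at \<open>1, \<dots>, r\<close> matter; conditions on entries with index below \<open>1\<close> are void.
\<close>

definition type_paths :: "nat \<Rightarrow> (nat \<Rightarrow> nat) \<Rightarrow> bool" where
  "type_paths r k \<longleftrightarrow>
    k r = 0 \<and> (r \<ge> 2 \<longrightarrow> k (r - 1) \<in> {0, 1}) \<and> (\<forall>i. 1 \<le> i \<and> i + 2 \<le> r \<longrightarrow> k i = 1)"

definition threshold :: "nat \<Rightarrow> int" where
  "threshold h = \<lceil>sqrt (real h + 5 / 4) - 1 / 2\<rceil>"

definition log_bound :: "nat \<Rightarrow> nat \<Rightarrow> nat \<Rightarrow> (nat \<Rightarrow> nat) \<Rightarrow> bool" where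
  "log_bound n h r k \<longleftrightarrow> (n > 5 * h\<^sup>2 \<longrightarrow> (\<forall>i\<in>{2..r}. real (k i) \<le> ln (6 * real h)))"

text \<open>
  The side condition on the common value of \<open>k\<^sub>2, \<dots>, k\<^sub>r\<close> is required to hold whenever there is
  such an entry; for \<open>r = 1\<close> there is none and \<open>k\<^sub>1\<close> is not restricted by it.
\<close>

definition type_one_large :: "nat \<Rightarrow> nat \<Rightarrow> nat \<Rightarrow> (nat \<Rightarrow> nat) \<Rightarrow> bool" where
  "type_one_large n h r k \<longleftrightarrow>
    int (k 1) > threshold h \<and>
    (\<forall>i\<in>{2..r}. int (k i) = \<lfloor>(real h + 1) / (real (k 1) + 1)\<rfloor> \<and>
      real_of_int \<lfloor>(real h + 1) / (real (k 1) + 1)\<rfloor> \<ge> (real h + 1) / real (k 1) - 1) \<and>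
    log_bound n h r k"

definition type_even :: "nat \<Rightarrow> nat \<Rightarrow> nat \<Rightarrow> (nat \<Rightarrow> nat) \<Rightarrow> bool" where
  "type_even n h r k \<longleftrightarrow>
    int (k 1) \<le> threshold h \<and>
    (\<forall>i\<in>{1..r}. \<forall>j\<in>{1..r}. \<bar>int (k i) - int (k j)\<bar> \<le> 1) \<and>
    log_bound n h r k"

end

theory Submission
  imports Defs "HOL-Library.Multiset" "HOL-Library.Nat_Bijection" "HOL-Library.FuncSet"
begin

text \<open>
  A set of vertices of a tree is a root-containing subtree iff it contains the root and is closed
  under taking parents. So the number of these subtrees is the product over the branches \<open>B\<close> of
  \<open>1 + N B\<close>, where \<open>N\<close> counts the subtrees of \<open>B\<close> at its root, and an \<open>f\<close>-split contributes the
  factor \<open>h + 1 + f (f + 1)\<close> while using up \<open>h + f\<close> vertices. Two things have to be shown.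

  Splits suffice. A forest with at most \<open>h\<close> levels and at least \<open>h\<close> vertices can be replaced by
  splits with the same total size, without increasing the product. This is proved by
  building up the forest from its parts: putting forests side by side (\<open>dominated_add\<close>) and adding
  a common root below which the forest hangs (\<open>dominated_add_root\<close>). With three or more parts
  under a common root, one of them can be pulled out to become a branch of its own, paid for by one
  vertex of another part, and the product does not grow. So only one or two parts remain, and these
  cases are settled by explicit inequalities. For an arbitrary tree the build-up follows a parent
  function obtained from distances (\<open>dominated_num_root_subtrees\<close>); conversely a tree
  with prescribed splits as branches stays within the product (\<open>num_root_subtrees_split_tree\<close>).

  The best splits. It remains to minimise \<open>\<Prod> (h + 1 + k\<^sub>i (k\<^sub>i + 1))\<close> over multisets of numbers
  \<open>k\<^sub>i < h\<close> with \<open>\<Sum> (h + k\<^sub>i)\<close> fixed. Moving one unit between two entries shows, for entries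
  \<open>y \<le> x\<close> of a minimiser, that \<open>y (x + 1) \<le> h + 1\<close> (otherwise spreading them apart gains) and, if
  \<open>y + 2 \<le> x\<close>, that \<open>x (y + 1) \<ge> h + 1\<close> (otherwise moving them together gains). Let \<open>x\<close> be the
  largest entry. If \<open>x (x - 1) > h\<close>, that is, if \<open>x\<close> exceeds the threshold, the two inequalities
  confine every other entry to the interval from \<open>(h + 1) / x - 1\<close> to
  \<open>(h + 1) / (x + 1)\<close>, whose length is less than one; otherwise no entry can be smaller than
  \<open>x - 1\<close>. Finally, if \<open>n > 5 h\<^sup>2\<close> there are more than \<open>h\<close> entries, and lowering \<open>h\<close> of them
  by one frees exactly the vertices of a new path. The path costs a factor \<open>h + 1\<close>, the lowered
  entries of size about \<open>y\<close> together gain at least a factor of about \<open>exp (- y)\<close>, so \<open>y\<close> cannot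
  be much larger than \<open>ln (h + 1)\<close>.
\<close>

section \<open>Forests dominated by splits\<close>

text \<open>
  The number of subtrees of an \<open>f\<close>-split containing its root, plus one for the empty set: such a set
  either ends above the fork, which is vertex \<open>h - f\<close> of the spine (\<open>h - f\<close> possibilities, including
  the empty set), or contains the fork and goes \<open>0, \<dots>, f\<close> steps into each of the two legs.
\<close>

definition split_count :: "nat \<Rightarrow> nat \<Rightarrow> nat" where
  "split_count h f = h + 1 + f * (f + 1)"

definition splits_of_size :: "nat \<Rightarrow> nat \<Rightarrow> nat multiset \<Rightarrow> bool" where
  "splits_of_size h m F \<longleftrightarrow> (\<forall>f\<in>#F. f < h) \<and> (\<Sum>f\<in>#F. h + f) = m"

text \<open>
  The induction statement on forests of at most \<open>h\<close> levels with \<open>m\<close> vertices and \<open>v\<close>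
  parent-closed vertex sets: splits do at least as well. Below \<open>h\<close> vertices no split fits, and the
  single path with its \<open>m + 1\<close> closed sets takes their place.
\<close>

definition dominated :: "nat \<Rightarrow> nat \<Rightarrow> nat \<Rightarrow> bool" where
  "dominated h m v \<longleftrightarrow> m < h \<and> m < v \<or>
     (\<exists>F. splits_of_size h m F \<and> (\<Prod>f\<in>#F. split_count h f) \<le> v)"

lemma dominated_short: "m < h \<Longrightarrow> m < v \<Longrightarrow> dominated h m v"
  by (simp add: dominated_def)

lemma dominated_splits:
  "splits_of_size h m F \<Longrightarrow> (\<Prod>f\<in>#F. split_count h f) \<le> v \<Longrightarrow> dominated h m v"
  by (auto simp: dominated_def)

lemma dominated_split: "f < h \<Longrightarrow> split_count h f \<le> v \<Longrightarrow> dominated h (h + f) v"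
  by (rule dominated_splits[of _ _ "{#f#}"]) (auto simp: splits_of_size_def)

lemma dominated_two_splits:
  "f < h \<Longrightarrow> g < h \<Longrightarrow> split_count h f * split_count h g \<le> v \<Longrightarrow> dominated h (2 * h + f + g) v"
  by (rule dominated_splits[of _ _ "{#f, g#}"]) (auto simp: splits_of_size_def)

lemma dominated_mono: "dominated h m v \<Longrightarrow> v \<le> w \<Longrightarrow> dominated h m w"
  unfolding dominated_def by (meson le_trans less_le_trans)

lemma splits_of_size_union:
  "splits_of_size h m F \<Longrightarrow> splits_of_size h m' F' \<Longrightarrow> splits_of_size h (m + m') (F + F')"
  by (auto simp: splits_of_size_def)

lemma split_count_pos: "split_count h f > 0"
  by (simp add: split_count_def)

lemma prod_split_count_pos: "(\<Prod>f\<in>#F. split_count h f) > 0"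
  by (induction F) (auto simp: split_count_pos)

text \<open>
  Two paths of \<open>p\<close> and \<open>q\<close> vertices become one path if that fits into \<open>h\<close> levels, and otherwise the
  split with the \<open>p + q - h\<close> vertices that do not fit on its second leg.
\<close>

lemma dominated_two_short:
  assumes "p < h" "q < h"
  shows "dominated h (p + q) ((p + 1) * (q + 1))"
proof (cases "p + q < h")
  case True
  then show ?thesis by (intro dominated_short) auto
next
  case False
  then obtain f where f: "p + q = h + f" by (metis le_iff_add not_less)
  have "f * f \<le> p * q" using assms f by (intro mult_mono) auto
  then have "split_count h f \<le> (p + 1) * (q + 1)" using f by (simp add: split_count_def algebra_simps)
  then show ?thesis unfolding f using assms f by (intro dominated_split) auto
qed

text \<open>
  The \<open>p\<close> vertices of a short path lengthen both legs of the split if there is room; otherwise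
  the path is completed to \<open>h\<close> vertices at the expense of the legs of the split.
\<close>

lemma dominated_short_split:
  assumes p: "p < h" and f: "f < h"
  shows "dominated h (p + (h + f)) ((p + 1) * split_count h f)"
proof (cases "p + f < h")
  case True
  have "p * (f + p) \<le> p * (h + f * f)" using True by (intro mult_left_mono) (auto intro: trans_le_add1)
  then have "split_count h (p + f) \<le> (p + 1) * split_count h f"
    by (simp add: split_count_def algebra_simps)
  then have "dominated h (h + (p + f)) ((p + 1) * split_count h f)"
    using True by (intro dominated_split)
  then show ?thesis by (simp add: add_ac)
next
  case False
  define d where "d = h - p"
  have d: "h = p + d" "d \<ge> 1" "d \<le> f" using p False by (auto simp: d_def)
  then obtain g where g: "f = d + g" by (metis le_iff_add)
  obtain e where e: "p = g + Suc e" using f d g by (metis add_Suc_right less_natE add.commute add_less_cancel_left)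
  obtain c where c: "d = Suc c" using d by (cases d) auto
  have "split_count h 0 * split_count h g \<le> (p + 1) * split_count h f"
    unfolding split_count_def d(1) g e c by (simp add: algebra_simps)
  then have "dominated h (2 * h + 0 + g) ((p + 1) * split_count h f)"
    using f g d by (intro dominated_two_splits) auto
  then show ?thesis using d g by (simp add: add_ac mult_2)
qed

lemma dominated_add:
  assumes "dominated h m v" "dominated h n w"
  shows "dominated h (m + n) (v * w)"
proof -
  have short_any: "dominated h (p + n) (v * w)"
    if p: "p < h" "p < v" and n: "dominated h n w" for p n v w
    using n[unfolded dominated_def]
  proof (elim disjE exE conjE)
    assume "n < h" "n < w"
    then have "(p + 1) * (n + 1) \<le> v * w" using p by (intro mult_mono) auto
    with dominated_two_short[OF p(1) \<open>n < h\<close>] show ?thesis by (rule dominated_mono)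
  next
    fix F assume F: "splits_of_size h n F" "(\<Prod>f\<in>#F. split_count h f) \<le> w"
    show ?thesis
    proof (cases F)
      case empty
      then have "n = 0" "w \<ge> 1" using F by (auto simp: splits_of_size_def)
      then have "v \<le> v * w" by auto
      with p(2) have "p < v * w" by linarith
      then show ?thesis using p \<open>n = 0\<close> by (intro dominated_short) auto
    next
      case (add f F')
      let ?P = "\<Prod>g\<in>#F'. split_count h g"
      define n' where "n' = (\<Sum>g\<in>#F'. h + g)"
      have f: "f < h" and n': "n = h + f + n'" and F': "splits_of_size h n' F'"
        using F(1) unfolding add n'_def by (auto simp: splits_of_size_def)
      have le: "(p + 1) * split_count h f * ?P \<le> v * w"
        unfolding mult.assoc using p(2) F(2) add by (intro mult_mono) auto
      from dominated_short_split[OF p(1) f] show ?thesis unfolding dominated_def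
      proof (elim disjE exE conjE)
        fix G assume "splits_of_size h (p + (h + f)) G"
          "(\<Prod>g\<in>#G. split_count h g) \<le> (p + 1) * split_count h f"
        with F' le have "splits_of_size h (p + (h + f) + n') (G + F')"
          "(\<Prod>g\<in>#G + F'. split_count h g) \<le> v * w"
          by (auto intro: splits_of_size_union elim!: order_trans[rotated] intro!: mult_right_mono)
        then show "p + n < h \<and> p + n < v * w \<or> (\<exists>F. splits_of_size h (p + n) F \<and>
            (\<Prod>f\<in>#F. split_count h f) \<le> v * w)"
          unfolding n' by (auto simp: add_ac)
      qed simp
    qed
  qed
  from assms(1)[unfolded dominated_def] show ?thesis
  proof (elim disjE exE conjE)
    assume "m < h" "m < v"
    then show ?thesis using short_any assms(2) by blast
  next
    fix F assume F: "splits_of_size h m F" "(\<Prod>f\<in>#F. split_count h f) \<le> v"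
    from assms(2)[unfolded dominated_def] show ?thesis
    proof (elim disjE exE conjE)
      assume "n < h" "n < w"
      then show ?thesis using short_any[of n w m v] assms(1) by (simp add: add_ac mult_ac)
    next
      fix G assume "splits_of_size h n G" "(\<Prod>f\<in>#G. split_count h f) \<le> w"
      with F show ?thesis
        by (intro dominated_splits[of _ _ "F + G"]) (auto intro: splits_of_size_union mult_mono)
    qed
  qed
qed

lemma mset_size_ge_3_sorted:
  fixes F :: "'a::linorder multiset"
  assumes "size F \<ge> 3"
  obtains x y z G where "F = {#x, y, z#} + G" "x \<le> y" "y \<le> z"
proof -
  define l where "l = sorted_list_of_multiset F"
  have l: "mset l = F" "sorted l" by (auto simp: l_def)
  have "length l \<ge> 3" using assms l(1) by (metis size_mset)
  then obtain x y z zs where "l = x # y # z # zs" by (cases l rule: remdups_adj.cases; cases "tl (tl l)") auto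
  with l that[of x y z "mset zs"] show thesis by auto
qed

text \<open>
  A new root joining two splits of spine \<open>h\<close>: cutting the two apart gives two splits of spine
  \<open>h + 1\<close>. This takes two new spine vertices, namely the removed root and one vertex of a leg.
\<close>

lemma dominated_add_root_two:
  assumes f: "f < h" and g: "g < h" and "0 < f"
  shows "dominated (Suc h) (Suc (2 * h + f + g)) (split_count h f * split_count h g + 1)"
proof -
  obtain e where e: "f = Suc e" using \<open>0 < f\<close> by (cases f) auto
  obtain c where c: "h = e + c + 2" using f e by (metis Suc_leI le_iff_add add_Suc_right add_Suc Suc_lessE add_2_eq_Suc' less_natE)
  have "split_count (Suc h) e * split_count (Suc h) g \<le> split_count h f * split_count h g + 1"
    unfolding split_count_def e c by (simp add: algebra_simps)
  then have "dominated (Suc h) (2 * Suc h + e + g) (split_count h f * split_count h g + 1)"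
    using f g e by (intro dominated_two_splits) auto
  then show ?thesis by (simp add: e)
qed

text \<open>
  A forest under a new root is handled according to its number of parts. One split
  just gets a longer stem; two paths form a split with a stem of one vertex; two other splits are
  cut apart. From three parts \<open>x \<le> y \<le> z\<close> on, the middle one is
  pulled out with a stem vertex of its own, and a vertex of the smallest is removed in exchange. With
  closed-set counts \<open>a + 1\<close> and \<open>b\<close> for \<open>x\<close> and \<open>y\<close>, and \<open>P\<close> for all other parts together, this
  turns \<open>(a + 1) b P + 1\<close> into at most \<open>(a P + 1) (b + 1)\<close>, which is no larger since
  \<open>a + 1 \<le> b \<le> P\<close>; and the remaining tree is smaller, so that induction applies.
\<close>

lemma dominated_add_root:
  assumes "dominated h m v"
  shows "dominated (Suc h) (Suc m) (v + 1)"
  using assms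
proof (induction m arbitrary: v rule: less_induct)
  case (less m)
  from less.prems[unfolded dominated_def] show ?case
  proof (elim disjE exE conjE)
    assume "m < h" "m < v"
    then show ?thesis by (intro dominated_short) auto
  next
    fix F assume F: "splits_of_size h m F" "(\<Prod>f\<in>#F. split_count h f) \<le> v"
    consider "F = {#}" | f where "F = {#f#}" | f g where "F = {#f, g#}" | "size F \<ge> 3"
    proof -
      obtain l where l: "mset l = F" using ex_mset by blast
      consider "l = []" | f where "l = [f]" | f g where "l = [f, g]" | x y z k where "l = x # y # z # k"
        by (metis neq_Nil_conv)
      then show thesis using that l by cases auto
    qed
    then show ?thesis
    proof cases
      case 1
      then have "m = 0" "v \<ge> 1" using F by (auto simp: splits_of_size_def)
      show ?thesis
      proof (cases h)
        case 0
        then have "dominated (Suc h) (Suc h + 0) (v + 1)"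
          using \<open>v \<ge> 1\<close> by (intro dominated_split) (auto simp: split_count_def)
        then show ?thesis using 0 \<open>m = 0\<close> by simp
      qed (use \<open>m = 0\<close> \<open>v \<ge> 1\<close> in \<open>auto intro: dominated_short\<close>)
    next
      case (2 f)
      then have "f < h" "m = h + f" "split_count h f \<le> v" using F by (auto simp: splits_of_size_def)
      then have "dominated (Suc h) (Suc h + f) (v + 1)"
        by (intro dominated_split) (auto simp: split_count_def)
      then show ?thesis using \<open>m = h + f\<close> by simp
    next
      case (3 f g)
      then have fg: "f < h" "g < h" "m = 2 * h + f + g" "split_count h f * split_count h g + 1 \<le> v + 1"
        using F by (auto simp: splits_of_size_def)
      consider "f = 0 \<and> g = 0" | "0 < f" | "0 < g" by blast
      then show ?thesis
      proof cases
        case 1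
        then have "split_count (Suc h) h \<le> v + 1" using fg by (simp add: split_count_def)
        then have "dominated (Suc h) (Suc h + h) (v + 1)"
          using fg by (intro dominated_split) auto
        then show ?thesis using fg 1 by (simp add: mult_2)
      next
        case 2
        from dominated_mono[OF dominated_add_root_two[OF fg(1,2) this] fg(4)] show ?thesis
          by (simp add: fg)
      next
        case 3
        from dominated_add_root_two[OF fg(2,1) this] have
          "dominated (Suc h) (Suc m) (split_count h f * split_count h g + 1)"
          by (simp add: fg add_ac mult_ac)
        then show ?thesis using fg(4) by (rule dominated_mono)
      qed
    next
      case 4
      then obtain x y z G where G: "F = {#x, y, z#} + G" "x \<le> y" "y \<le> z"
        by (rule mset_size_ge_3_sorted)
      define a b where "a = split_count h x - 1" and "b = split_count h y"
      define P where "P = (\<Prod>f\<in>#{#z#} + G. split_count h f)"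
      define n where "n = (\<Sum>f\<in>#{#z#} + G. h + f)"
      have lt: "x < h" "y < h" "z < h" and m: "m = (h + x) + (h + y) + n"
        and rest: "splits_of_size h n ({#z#} + G)"
        using F(1) unfolding G(1) n_def by (auto simp: splits_of_size_def)
      have a: "split_count h x = a + 1" by (simp add: a_def split_count_def)
      have ab: "a + 1 \<le> b" unfolding a[symmetric] b_def split_count_def
        using G(2) by (intro add_mono mult_mono) auto
      have "b \<le> split_count h z" unfolding b_def split_count_def
        using G(3) by (intro add_mono mult_mono) auto
      also have "\<dots> \<le> P" using prod_split_count_pos[of h G] unfolding P_def by simp
      finally have bP: "b \<le> P" .
      have v: "(a + 1) * b * P \<le> v" using F(2) unfolding G(1) P_def b_def a[symmetric] by (simp add: mult_ac)
      \<comment> \<open>The part \<open>x\<close> loses a leaf; if it is a path, it becomes a short path.\<close>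
      have "dominated h (h + x - 1) a"
      proof (cases x)
        case 0
        then show ?thesis using lt by (intro dominated_short) (auto simp: a_def split_count_def)
      next
        case (Suc x')
        then have "dominated h (h + x') a" using lt
          by (intro dominated_split) (auto simp: a_def split_count_def)
        then show ?thesis using Suc by simp
      qed
      moreover have "dominated h n P" using rest by (rule dominated_splits) (simp add: P_def)
      ultimately have "dominated h (h + x - 1 + n) (a * P)" by (rule dominated_add)
      then have "dominated (Suc h) (Suc (h + x - 1 + n)) (a * P + 1)"
        using lt m by (intro less.IH) auto
      moreover have "dominated (Suc h) (Suc h + y) (b + 1)"
        using lt by (intro dominated_split) (auto simp: b_def split_count_def)
      ultimately have "dominated (Suc h) (Suc (h + x - 1 + n) + (Suc h + y)) ((a * P + 1) * (b + 1))"
        by (rule dominated_add)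
      moreover have "Suc (h + x - 1 + n) + (Suc h + y) = Suc m" using m lt by simp
      moreover have "(a * P + 1) * (b + 1) \<le> v + 1"
      proof -
        have "(a + 1) * P \<le> b * P" using ab by (rule mult_right_mono) simp
        then have "(a * P + 1) * (b + 1) \<le> (a + 1) * b * P + 1" using bP by (simp add: algebra_simps)
        with v show ?thesis by linarith
      qed
      ultimately show ?thesis by (metis dominated_mono)
    qed
  qed
qed

section \<open>Minimal multisets of splits\<close>

definition minimal_splits :: "nat \<Rightarrow> nat \<Rightarrow> nat multiset \<Rightarrow> bool" where
  "minimal_splits h m F \<longleftrightarrow> splits_of_size h m F \<and>
     (\<forall>G. splits_of_size h m G \<longrightarrow> (\<Prod>f\<in>#F. split_count h f) \<le> (\<Prod>f\<in>#G. split_count h f))"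

lemma minimal_splits_exchange:
  assumes F: "minimal_splits h m (A + C)" and B: "\<forall>f\<in>#B. f < h"
    and sum: "(\<Sum>f\<in>#A. h + f) = (\<Sum>f\<in>#B. h + f)"
  shows "(\<Prod>f\<in>#A. split_count h f) \<le> (\<Prod>f\<in>#B. split_count h f)"
proof -
  have "splits_of_size h m (B + C)"
    using assms by (auto simp: minimal_splits_def splits_of_size_def)
  then have "(\<Prod>f\<in>#A + C. split_count h f) \<le> (\<Prod>f\<in>#B + C. split_count h f)"
    using F by (auto simp: minimal_splits_def)
  then show ?thesis using prod_split_count_pos[of h C] by simp
qed

text \<open>
  Exchange identity: for fixed sum of two entries the product of their counts is a quadratic
  polynomial in the product of the entries, so the effect of moving one unit factorises.
\<close>

lemma split_count_shift:
  "int (split_count h x * split_count h (Suc y)) - int (split_count h (Suc x) * split_count h y)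
    = 2 * (int x - int y) * (int (Suc y * Suc x) - int (h + 1))"
  unfolding split_count_def by (simp add: algebra_simps)

text \<open>
  An entry \<open>h - 1\<close> cannot be increased. Instead of spreading such a pair further, it is
  replaced by three splits, two of them paths.
\<close>

lemma split_count_full_pair:
  assumes "1 \<le> y" "Suc y < h"
  shows "split_count h 0 * split_count h 0 * split_count h y
    < split_count h (h - 1) * split_count h (Suc y)"
proof -
  define B where "B = split_count h y"
  obtain d where d: "h = Suc (Suc y) + d" using assms by (metis Suc_leI le_iff_add)
  obtain c where c: "y = Suc c" using assms by (cases y) auto
  have "h * split_count h (Suc y) < Suc y * (h + 1) ^ 2"
    unfolding split_count_def d c power2_eq_square by (simp add: algebra_simps)
  moreover have B: "split_count h (Suc y) = B + 2 * Suc y" by (simp add: B_def split_count_def)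
  ultimately have less: "(h + 1) ^ 2 * B < (h ^ 2 + 1) * (B + 2 * Suc y)"
    by (simp add: power2_eq_square algebra_simps)
  have full: "split_count h (h - 1) = h ^ 2 + 1"
    using assms(2) by (cases h) (auto simp: split_count_def power2_eq_square)
  have "split_count h 0 * split_count h 0 * split_count h y = (h + 1) ^ 2 * B"
    by (simp add: B_def split_count_def power2_eq_square)
  then show ?thesis using less by (simp only: B full)
qed

lemma minimal_splits_not_spread:
  assumes F: "minimal_splits h m ({#x, y#} + C)" and "y \<le> x"
  shows "y * (x + 1) \<le> h + 1"
proof (cases y)
  case (Suc z)
  have lt: "x < h" "y < h" using F by (auto simp: minimal_splits_def splits_of_size_def)
  show ?thesis
  proof (cases "Suc x < h")
    case True
    \<comment> \<open>Spread the two entries apart by one unit each.\<close>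
    have "split_count h x * split_count h y \<le> split_count h (Suc x) * split_count h z"
      using minimal_splits_exchange[OF F, of "{#Suc x, z#}"] True lt Suc by simp
    then have "2 * (int x - int z) * (int (Suc z * Suc x) - int (h + 1)) \<le> 0"
      unfolding split_count_shift[symmetric] Suc by linarith
    moreover have "2 * (int x - int z) > 0" using Suc \<open>y \<le> x\<close> by simp
    ultimately have "int (Suc z * Suc x) \<le> int (h + 1)"
      by (smt (verit) mult_pos_pos)
    then show ?thesis unfolding Suc by (simp only: of_nat_le_iff Suc_eq_plus1)
  next
    case False
    then have x: "x = h - 1" "h \<ge> 1" using lt by auto
    have "z = 0"
    proof (rule ccontr)
      assume "z \<noteq> 0"
      then have "split_count h 0 * split_count h 0 * split_count h z < split_count h x * split_count h y"
        using split_count_full_pair[of z h] lt Suc x by simp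
      moreover have "split_count h x * split_count h y \<le> split_count h 0 * split_count h 0 * split_count h z"
        using minimal_splits_exchange[OF F, of "{#0, 0, z#}"] x lt Suc by simp
      ultimately show False by simp
    qed
    then show ?thesis using Suc x by simp
  qed
qed simp

lemma minimal_splits_not_clustered:
  assumes F: "minimal_splits h m ({#x, y#} + C)" and "y + 2 \<le> x"
  shows "h + 1 \<le> x * (y + 1)"
proof -
  obtain z where z: "x = Suc z" using assms(2) by (cases x) auto
  have lt: "x < h" using F by (auto simp: minimal_splits_def splits_of_size_def)
  \<comment> \<open>Move the two entries together by one unit each.\<close>
  have "split_count h x * split_count h y \<le> split_count h z * split_count h (Suc y)"
    using minimal_splits_exchange[OF F, of "{#z, Suc y#}"] lt z assms(2) by simp
  then have "2 * (int z - int y) * (int (Suc y * Suc z) - int (h + 1)) \<ge> 0"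
    unfolding split_count_shift[symmetric] z by linarith
  moreover have "2 * (int z - int y) > 0" using assms(2) z by simp
  ultimately have "int (h + 1) \<le> int (Suc y * Suc z)" by (simp only: zero_le_mult_iff) linarith
  then show ?thesis unfolding z by (simp only: of_nat_le_iff Suc_eq_plus1 mult.commute)
qed

text \<open>
  \<open>sqrt (h + 5/4) - 1/2\<close> is the positive root of \<open>t (t + 1) = h + 1\<close>.
\<close>

lemma threshold_less_iff: "threshold h < int x \<longleftrightarrow> h + 1 \<le> x * (x - 1)"
proof (cases x)
  case 0
  have "sqrt (real h + 5 / 4) \<ge> sqrt (1/4)" by (intro real_sqrt_le_mono) auto
  then have "sqrt (real h + 5 / 4) - 1 / 2 > -1" by (simp add: real_sqrt_divide)
  then have "threshold h \<ge> 0" unfolding threshold_def by linarith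
  then show ?thesis using 0 by simp
next
  case (Suc y)
  have "threshold h < int x \<longleftrightarrow> threshold h \<le> int y" using Suc by auto
  also have "\<dots> \<longleftrightarrow> sqrt (real h + 5 / 4) \<le> real y + 1 / 2"
    unfolding threshold_def ceiling_le_iff by auto
  also have "\<dots> \<longleftrightarrow> real h + 5 / 4 \<le> (real y + 1 / 2)\<^sup>2"
    by (subst real_sqrt_le_iff[symmetric]) simp
  also have "\<dots> \<longleftrightarrow> real (h + 1) \<le> real (x * (x - 1))"
    unfolding Suc by (auto simp: power2_eq_square algebra_simps)
  finally show ?thesis by linarith
qed

text \<open>
  Both exchange inequalities apply, and the bounds they give differ by less than one.
\<close>

lemma minimal_splits_one_large:
  assumes F: "minimal_splits h m ({#x, y#} + C)" and le: "y \<le> x" and x: "h + 1 \<le> x * (x - 1)"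
  shows "int y = \<lfloor>(real h + 1) / (real x + 1)\<rfloor>" "real y \<ge> (real h + 1) / real x - 1"
proof -
  have x0: "x > 0" using x by (cases x) auto
  have upper: "y * (x + 1) \<le> h + 1" by (rule minimal_splits_not_spread[OF F le])
  have "y + 2 \<le> x"
  proof (rule ccontr)
    assume "\<not> y + 2 \<le> x"
    then have "(x - 1) * (x + 1) \<le> y * (x + 1)" by (intro mult_right_mono) auto
    also note upper
    also note x
    also have "x * (x - 1) < (x - 1) * (x + 1)" using x by (cases "x - 1") auto
    finally show False by simp
  qed
  then have lower: "h + 1 \<le> x * (y + 1)" by (rule minimal_splits_not_clustered[OF F])
  have "real (y * (x + 1)) \<le> real (h + 1)" "real (h + 1) \<le> real (x * (y + 1))"
    using upper lower by (simp_all only: of_nat_le_iff)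
  then have *: "real y \<le> (real h + 1) / (real x + 1)" "(real h + 1) / real x \<le> real y + 1"
    using x0 by (simp_all add: field_simps)
  have "(real h + 1) / (real x + 1) < (real h + 1) / real x"
    using x0 by (intro divide_strict_left_mono) auto
  with * show "int y = \<lfloor>(real h + 1) / (real x + 1)\<rfloor>" by (intro floor_unique[symmetric]) auto
  show "real y \<ge> (real h + 1) / real x - 1" using * by simp
qed

lemma minimal_splits_even:
  assumes F: "minimal_splits h m ({#x, y#} + C)" and "\<not> h + 1 \<le> x * (x - 1)"
  shows "x \<le> y + 1"
proof (rule ccontr)
  assume a: "\<not> x \<le> y + 1"
  then have "h + 1 \<le> x * (y + 1)" by (intro minimal_splits_not_clustered[OF F]) auto
  also have "\<dots> \<le> x * (x - 1)" using a by (intro mult_left_mono) auto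
  finally show False using assms(2) by simp
qed

section \<open>A logarithmic bound for many splits\<close>

text \<open>
  As \<open>y (y + 1) \<le> h + 1\<close>, the loss \<open>2 y\<close> is taken from a count of at most \<open>2 (h + 1)\<close>.
\<close>

lemma split_count_decrement:
  assumes "1 \<le> y" "y * (y + 1) \<le> h + 1" "k \<le> y"
  shows "real (split_count h (y - 1)) \<le> (1 - real k / (real h + 1)) * real (split_count h y)"
proof -
  obtain z where z: "y = Suc z" using assms(1) by (cases y) auto
  have "split_count h y \<le> 2 * (h + 1)" using assms(2) by (simp add: split_count_def)
  then have "real (split_count h y) \<le> real (2 * (h + 1))" by (simp only: of_nat_le_iff)
  then have "real (split_count h y) \<le> 2 * (real h + 1)" by simp
  then have "real k * real (split_count h y) \<le> real y * (2 * (real h + 1))"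
    using assms(3) by (intro mult_mono) auto
  then have "real k / (real h + 1) * real (split_count h y) \<le> 2 * real y"
    by (simp add: field_simps)
  moreover have "real (split_count h (y - 1)) = real (split_count h y) - 2 * real y"
    unfolding z split_count_def by (simp add: algebra_simps)
  ultimately show ?thesis by (simp add: algebra_simps)
qed

lemma real_prod_mset: "real (\<Prod>x\<in>#B. f x) = (\<Prod>x\<in>#B. real (f x))"
  by (induction B) auto

lemma prod_mset_le_power_mult:
  assumes "\<forall>x\<in>#B. 0 \<le> f x \<and> f x \<le> c * (g x :: real)" "c \<ge> 0" "\<forall>x\<in>#B. g x \<ge> 0"
  shows "(\<Prod>x\<in>#B. f x) \<le> c ^ size B * (\<Prod>x\<in>#B. g x) \<and> 0 \<le> (\<Prod>x\<in>#B. f x)"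
  using assms
proof (induction B)
  case (add x B)
  then have IH: "(\<Prod>x\<in>#B. f x) \<le> c ^ size B * (\<Prod>x\<in>#B. g x)" "0 \<le> (\<Prod>x\<in>#B. f x)"
    and x: "0 \<le> f x" "f x \<le> c * g x" by auto
  then have "f x * (\<Prod>x\<in>#B. f x) \<le> (c * g x) * (c ^ size B * (\<Prod>x\<in>#B. g x))"
    by (intro mult_mono) auto
  then show ?case using IH x by (simp add: mult_ac)
qed simp

text \<open>
  The slack between \<open>ln (6 h) - 1\<close> and \<open>ln (h + 1)\<close> absorbs the factor \<open>h / (h + 1)\<close>: it is at least
  \<open>ln (2 h / (h + 1))\<close>, because \<open>exp 1 \<le> 3\<close>.
\<close>

lemma log_inequality:
  assumes "h \<ge> 5" "real k > ln (6 * real h) - 1"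
  shows "ln (real h + 1) < real k * real h / (real h + 1)"
proof -
  have h: "real h \<ge> 5" using assms(1) by simp
  have "ln (6 * real h) - 1 \<ge> ln (2 * real h)"
  proof -
    have "ln (3::real) \<ge> 1" using exp_le by (subst ln_ge_iff) auto
    moreover have "ln (6 * real h) = ln 3 + ln (2 * real h)"
      using h ln_mult[of 3 "2 * real h"] by simp
    ultimately show ?thesis by simp
  qed
  with assms(2) have k: "real k > ln (2 * real h)" by simp
  have "ln (real h + 1) * (real h + 1) \<le> ln (2 * real h) * real h"
  proof -
    have "ln ((real h + 1) / (2 * real h)) \<le> (real h + 1) / (2 * real h) - 1"
      using h by (intro ln_le_minus_one) auto
    then have "ln (real h + 1) - ln (2 * real h) \<le> (real h + 1) / (2 * real h) - 1"
      using h by (simp add: ln_div)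
    then have "(ln (real h + 1) - ln (2 * real h)) * real h \<le> ((real h + 1) / (2 * real h) - 1) * real h"
      by (rule mult_right_mono) simp
    also have "\<dots> = (1 - real h) / 2" using h by (simp add: field_simps)
    finally have 1: "(ln (real h + 1) - ln (2 * real h)) * real h \<le> (1 - real h) / 2" .
    have "ln ((real h + 1) / 4) \<le> (real h + 1) / 4 - 1" by (intro ln_le_minus_one) auto
    moreover have "ln (real h + 1) = ln ((real h + 1) / 4) + ln 4"
      using h by (simp add: ln_div)
    moreover have "ln (4::real) \<le> 3/2"
    proof -
      have "(2::real) \<le> exp (3/4)"
        using exp_lower_Taylor_quadratic[of "3/4::real"] by (simp add: power2_eq_square)
      then have "ln (2::real) \<le> 3/4" using ln_le_cancel_iff[of 2 "exp (3/4)"] by simp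
      moreover have "ln (4::real) = 2 * ln 2" using ln_realpow[of 2 2] by simp
      ultimately show ?thesis by simp
    qed
    ultimately have "ln (real h + 1) \<le> (real h - 1) / 2" using h by argo
    with 1 show ?thesis by (simp add: algebra_simps)
  qed
  also have "\<dots> < real k * real h" using k h by simp
  finally show ?thesis using h by (simp add: field_simps)
qed

text \<open>
  The \<open>h\<close> entries of \<open>B\<close> are lowered by one, and the freed vertices form one more path. The
  entry \<open>x\<close> serves to bound those of \<open>B\<close> through the exchange inequality.
\<close>

lemma minimal_splits_few_large:
  assumes F: "minimal_splits h m (add_mset x (B + C))" and size: "size B = h" and h: "h \<ge> 5"
    and k: "1 \<le> k" "real k > ln (6 * real h) - 1" and B: "\<forall>y\<in>#B. k \<le> y \<and> y \<le> x"
  shows False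
proof -
  have small: "y * (y + 1) \<le> h + 1" if y: "y \<in># B" for y
  proof -
    obtain B' where "B = add_mset y B'" using y by (metis multi_member_split)
    with F have "minimal_splits h m ({#x, y#} + (B' + C))" by (simp add: add_ac)
    then have "y * (x + 1) \<le> h + 1" using y B by (intro minimal_splits_not_spread) auto
    moreover have "y * (y + 1) \<le> y * (x + 1)" using y B by (intro mult_left_mono) auto
    ultimately show ?thesis by linarith
  qed
  define c where "c = 1 - real k / (real h + 1)"
  obtain y where y: "y \<in># B" using size h by (metis not_numeral_le_zero size_empty multiset_nonemptyE)
  have "y * 1 \<le> y * (y + 1)" by (intro mult_left_mono) auto
  moreover have "k \<le> y" "y * (y + 1) \<le> h + 1" using y B small by auto
  ultimately have "k \<le> h + 1" by linarith
  then have c0: "c \<ge> 0" by (simp add: c_def field_simps)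
  let ?B = "image_mset (\<lambda>y. y - 1) B"
  have "\<forall>f\<in>#B. f < h" using F by (auto simp: minimal_splits_def splits_of_size_def)
  moreover have "(\<Sum>f\<in>#B. h + f) = (\<Sum>f\<in>#?B. h + f) + size B"
    using B k(1) by (induction B) auto
  moreover have "minimal_splits h m (B + add_mset x C)" using F by simp
  ultimately have "(\<Prod>f\<in>#B. split_count h f) \<le> (\<Prod>f\<in>#add_mset 0 ?B. split_count h f)"
    using h size by (intro minimal_splits_exchange[of h m B "add_mset x C"]) auto
  also have "\<dots> = (\<Prod>f\<in>#?B. split_count h f) * split_count h 0" by (simp only: prod_mset.add_mset image_mset_add_mset mult.commute)
  also have "split_count h 0 = h + 1" by (simp add: split_count_def)
  finally have "real (\<Prod>f\<in>#B. split_count h f) \<le> real ((\<Prod>f\<in>#?B. split_count h f) * (h + 1))"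
    by (simp only: of_nat_le_iff)
  also have "\<dots> = (\<Prod>y\<in>#B. real (split_count h (y - 1))) * (real h + 1)"
    by (simp only: of_nat_mult real_prod_mset multiset.map_comp comp_def of_nat_Suc of_nat_add of_nat_1)
  also have "\<dots> \<le> c ^ size B * (\<Prod>y\<in>#B. real (split_count h y)) * (real h + 1)"
  proof (intro mult_right_mono)
    have "\<forall>y\<in>#B. 0 \<le> real (split_count h (y - 1)) \<and>
        real (split_count h (y - 1)) \<le> c * real (split_count h y)"
      unfolding c_def using split_count_decrement small B k(1) by auto
    then show "(\<Prod>y\<in>#B. real (split_count h (y - 1))) \<le> c ^ size B * (\<Prod>y\<in>#B. real (split_count h y))"
      by (rule conjunct1[OF prod_mset_le_power_mult[OF _ c0]]) simp
  qed simp
  finally have "real (\<Prod>f\<in>#B. split_count h f) * 1 \<le>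
      real (\<Prod>f\<in>#B. split_count h f) * (c ^ h * (real h + 1))"
    by (simp only: real_prod_mset size mult_ac mult_1_right)
  then have ge: "1 \<le> c ^ h * (real h + 1)"
    using prod_split_count_pos[of h B] by (subst (asm) mult_le_cancel_left_pos) auto
  have "c \<le> exp (- (real k / (real h + 1)))"
    unfolding c_def using exp_ge_add_one_self[of "- (real k / (real h + 1))"] by simp
  then have "c ^ h \<le> exp (- (real k / (real h + 1))) ^ h" using c0 by (rule power_mono)
  also have "\<dots> = exp (- (real k * real h / (real h + 1)))"
    by (simp add: exp_of_nat_mult[symmetric] mult_ac)
  also have "\<dots> < exp (- ln (real h + 1))" using log_inequality[OF h k(2)] by simp
  also have "\<dots> = 1 / (real h + 1)" by (simp add: exp_minus inverse_eq_divide)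
  finally show False using ge by (simp add: field_simps)
qed

lemma minimal_splits_log_bound:
  assumes F: "minimal_splits h m (mset (x # xs))" and h: "h > 0" and m: "m \<ge> 5 * h\<^sup>2"
    and xs: "\<forall>y\<in>set xs. y \<le> x" "\<forall>y\<in>set xs. \<forall>z\<in>set xs. y \<le> z + 1" and y: "y \<in> set xs"
  shows "real y \<le> ln (6 * real h)"
proof (rule ccontr)
  assume large: "\<not> ?thesis"
  have "ln (3::real) \<ge> 1" using exp_le by (subst ln_ge_iff) auto
  moreover have "ln 3 \<le> ln (6 * real h)" using h by (subst ln_le_cancel_iff) auto
  ultimately have y2: "y \<ge> 2" using large by linarith
  obtain C where "mset xs = add_mset y C" using y by (metis multi_member_split set_mset_mset)
  with F have "y * (x + 1) \<le> h + 1" using y xs(1)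
    by (intro minimal_splits_not_spread[of h m x y C]) auto
  moreover have "2 * (2 + 1) \<le> y * (x + 1)" using y2 y xs(1) by (intro mult_mono) auto
  ultimately have h5: "h \<ge> 5" by simp
  \<comment> \<open>Every split has fewer than \<open>2 h\<close> vertices.\<close>
  have "length xs \<ge> h"
  proof (rule ccontr)
    assume "\<not> ?thesis"
    have "m = sum_list (map (\<lambda>f. h + f) (x # xs))" "\<forall>f\<in>set (x # xs). f < h"
      using F unfolding minimal_splits_def splits_of_size_def
      by (auto simp: sum_mset_sum_list[symmetric] simp del: sum_mset_sum_list)
    then have "m \<le> sum_list (map (\<lambda>f. 2 * h) (x # xs))"
      by (auto intro!: add_mono sum_list_mono)
    also have "\<dots> = length (x # xs) * (2 * h)" by (simp only: map_replicate_const sum_list_replicate of_nat_id)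
    also have "\<dots> \<le> h * (2 * h)" using \<open>\<not> h \<le> length xs\<close> by (intro mult_right_mono) auto
    finally show False using m mult_pos_pos[OF h h] unfolding power2_eq_square by linarith
  qed
  have "minimal_splits h m (add_mset x (mset (take h xs) + mset (drop h xs)))"
    unfolding mset_append[symmetric] append_take_drop_id using F by simp
  moreover have "\<forall>z\<in>#mset (take h xs). y - 1 \<le> z \<and> z \<le> x"
  proof
    fix z assume "z \<in># mset (take h xs)"
    then have "z \<in> set xs" by (auto dest: in_set_takeD)
    then show "y - 1 \<le> z \<and> z \<le> x" using xs y by force
  qed
  moreover have "real (y - 1) > ln (6 * real h) - 1" using large y2 by (simp add: of_nat_diff)
  ultimately show False using \<open>length xs \<ge> h\<close> h5 y2
    by (intro minimal_splits_few_large[of h m x _ _ "y - 1"]) auto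
qed

section \<open>Existence and type of minimal multisets\<close>

lemma minimal_splits_exists:
  assumes "h > 0" "h \<le> m"
  obtains F where "minimal_splits h m F"
proof -
  obtain h' where h': "h = Suc h'" using assms by (cases h) auto
  have "dominated h 0 1" for h by (rule dominated_splits[of _ _ "{#}"]) (auto simp: splits_of_size_def)
  note 0 = this
  \<comment> \<open>The forest of \<open>m\<close> isolated vertices.\<close>
  have "dominated h m (2 ^ m)"
  proof (induction m)
    case (Suc m)
    from dominated_add[OF dominated_add_root[OF 0[of h'], folded h'] this] show ?case by (simp add: mult_2)
  qed (use 0 in simp)
  then obtain G where "splits_of_size h m G" using assms by (auto simp: dominated_def)
  from ex_has_least_nat[of "splits_of_size h m" G "\<lambda>F. \<Prod>f\<in>#F. split_count h f", OF this]
  obtain F where "minimal_splits h m F" unfolding minimal_splits_def by blast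
  then show thesis by (rule that)
qed

lemma minimal_splits_dominated:
  assumes "minimal_splits h m F" "dominated h m v" "h \<le> m"
  shows "(\<Prod>f\<in>#F. split_count h f) \<le> v"
proof -
  obtain G where "splits_of_size h m G" "(\<Prod>f\<in>#G. split_count h f) \<le> v"
    using assms(2,3) by (auto simp: dominated_def)
  then show ?thesis using assms(1) unfolding minimal_splits_def by (blast intro: le_trans)
qed

lemma minimal_splits_type:
  assumes F: "minimal_splits h m F" and h: "h > 0" "h \<le> m"
  obtains r k where "F = image_mset k (mset_set {1..r})"
    "\<forall>i j. 1 \<le> i \<and> i \<le> j \<and> j \<le> r \<longrightarrow> k j \<le> k i"
    "type_one_large (Suc m) h r k \<or> type_even (Suc m) h r k"
proof -
  define ks where "ks = rev (sorted_list_of_multiset F)"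
  have ks: "mset ks = F" "sorted (rev ks)" by (auto simp: ks_def)
  have "F \<noteq> {#}" using F h by (auto simp: minimal_splits_def splits_of_size_def)
  then obtain x xs where x: "ks = x # xs" using ks(1) by (cases ks) auto
  define r k where "r = length ks" and "k = (\<lambda>i. ks ! (i - 1))"
  have k1: "k 1 = x" by (simp add: k_def x)
  have tail: "k i \<in> set xs" if "i \<in> {2..r}" for i
  proof -
    obtain j where "i = Suc (Suc j)" using \<open>i \<in> {2..r}\<close> by (metis atLeastAtMost_iff le_iff_add add_2_eq_Suc)
    then show ?thesis using that by (simp add: k_def r_def x)
  qed
  have le: "\<forall>y\<in>set xs. y \<le> x" using ks(2) unfolding x by (auto simp: sorted_append)
  have split: "\<exists>C. minimal_splits h m ({#x, y#} + C)" if "y \<in> set xs" for y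
    using F multi_member_split[of y "mset xs"] that unfolding ks(1)[symmetric] x by fastforce
  have F': "minimal_splits h m (mset (x # xs))" using F ks(1) x by simp
  have "image_mset k (mset_set {1..r}) = image_mset k (image_mset Suc (mset_set {0..<r}))"
    by (subst image_mset_mset_set) (auto simp: image_Suc_atLeastLessThan atLeastLessThanSuc_atLeastAtMost)
  also have "\<dots> = mset (map ((!) ks) [0..<length ks])"
    by (simp add: multiset.map_comp comp_def k_def r_def)
  also have "\<dots> = F" unfolding map_nth ks(1) ..
  finally have 1: "F = image_mset k (mset_set {1..r})" by simp
  have 2: "\<forall>i j. 1 \<le> i \<and> i \<le> j \<and> j \<le> r \<longrightarrow> k j \<le> k i"
    using ks(2) unfolding k_def r_def by (auto intro!: sorted_rev_nth_mono)
  have log: "log_bound (Suc m) h r k" if "\<forall>y\<in>set xs. \<forall>z\<in>set xs. y \<le> z + 1"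
    unfolding log_bound_def using minimal_splits_log_bound[OF F' h(1) _ le that] tail by auto
  have 3: "type_one_large (Suc m) h r k \<or> type_even (Suc m) h r k"
  proof (cases "h + 1 \<le> x * (x - 1)")
    case True
    have one: "int y = \<lfloor>(real h + 1) / (real x + 1)\<rfloor> \<and> real y \<ge> (real h + 1) / real x - 1"
      if "y \<in> set xs" for y
      using split[OF that] minimal_splits_one_large True le that by metis
    then have "\<forall>y\<in>set xs. \<forall>z\<in>set xs. y = z" by (metis of_nat_eq_iff)
    then have "log_bound (Suc m) h r k" by (intro log) auto
    moreover have "threshold h < int (k 1)" using True unfolding k1 threshold_less_iff .
    moreover have "int (k i) = \<lfloor>(real h + 1) / (real (k 1) + 1)\<rfloor> \<and>
      real_of_int \<lfloor>(real h + 1) / (real (k 1) + 1)\<rfloor> \<ge> (real h + 1) / real (k 1) - 1"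
      if "i \<in> {2..r}" for i
      using one[OF tail[OF that]] unfolding k1 by (metis of_int_of_nat_eq)
    ultimately show ?thesis unfolding type_one_large_def by blast
  next
    case False
    have ge: "x \<le> y + 1" if "y \<in> set xs" for y
      using split[OF that] minimal_splits_even False by blast
    have near: "x \<le> k i + 1 \<and> k i \<le> x" if "i \<in> {1..r}" for i
    proof (cases "i = 1")
      case False
      with that have "k i \<in> set xs" by (intro tail) auto
      then show ?thesis using ge le by blast
    qed (use k1 in simp)
    have "\<forall>y\<in>set xs. \<forall>z\<in>set xs. y \<le> z + 1" using ge le by (meson le_trans)
    then have "log_bound (Suc m) h r k" by (rule log)
    moreover have "int (k 1) \<le> threshold h" using False unfolding k1 threshold_less_iff[symmetric] by simp
    moreover have "\<bar>int (k i) - int (k j)\<bar> \<le> 1" if "i \<in> {1..r}" "j \<in> {1..r}" for i j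
      using near[OF that(1)] near[OF that(2)] by linarith
    ultimately show ?thesis unfolding type_even_def by blast
  qed
  from that[OF 1 2 3] show thesis .
qed

section \<open>Lower bound for arbitrary rooted trees\<close>

lemma rtrancl_on_restrict: "rtrancl_on S (E \<inter> S \<times> S) = rtrancl_on S E"
proof -
  have "(a, b) \<in> rtrancl_on S (E \<inter> S \<times> S)" if "(a, b) \<in> rtrancl_on S E" for a b
    using that by (induct rule: rtrancl_on_induct) (auto intro: rtrancl_on_into_rtrancl_on)
  then show ?thesis by (auto intro: rtrancl_on_mono[of _ E S S])
qed

text \<open>
  The graph is symmetric, so connectedness only has to be tested from one vertex.
\<close>

lemma connected_induced_iff:
  assumes "sym (parcs G)" and r: "r \<in> S"
  shows "connected (with_proj G \<restriction> S) \<longleftrightarrow> (\<forall>v\<in>S. (r, v) \<in> rtrancl_on S (parcs G))"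
proof -
  have "arcs_ends (with_proj G \<restriction> S) = parcs G \<inter> S \<times> S"
    by (auto simp: arcs_ends_conv)
  moreover have "(parcs G \<inter> S \<times> S)\<^sup>s = parcs G \<inter> S \<times> S"
    using assms(1) by (auto simp: symcl_def dest: symD)
  ultimately have "connected (with_proj G \<restriction> S) \<longleftrightarrow> (\<forall>u\<in>S. \<forall>v\<in>S. (u, v) \<in> rtrancl_on S (parcs G))"
    using r by (auto simp: connected_conv rtrancl_on_restrict)
  then show ?thesis
    using r symD[OF rtrancl_on_sym[OF assms(1)]] rtrancl_on_trans by metis
qed

lemma num_root_subtrees_eq:
  assumes "pair_wf_digraph G" "sym (parcs G)"
  shows "num_root_subtrees G r =
    card {S. S \<subseteq> pverts G \<and> r \<in> S \<and> (\<forall>v\<in>S. (r, v) \<in> rtrancl_on S (parcs G))}" (is "_ = card ?X")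
proof -
  interpret pair_wf_digraph G by fact
  have "{H \<in> subtrees G. r \<in> verts H} = (\<lambda>S. with_proj G \<restriction> S) ` ?X" (is "?L = ?R")
  proof
    show "?L \<subseteq> ?R"
    proof
      fix H assume "H \<in> ?L"
      then have H: "induced_subgraph H (with_proj G)" "connected H" "r \<in> verts H"
        by (auto simp: subtrees_def)
      then have eq: "with_proj G \<restriction> verts H = H" by (intro induce_eq_iff_induced)
      moreover have "verts H \<subseteq> pverts G" using H(1) by (auto simp: induced_subgraph_def subgraph_def)
      moreover have "\<forall>v\<in>verts H. (r, v) \<in> rtrancl_on (verts H) (parcs G)"
        using connected_induced_iff[OF assms(2) H(3)] H(2) unfolding eq by simp
      ultimately show "H \<in> ?R" using H(3) by (intro image_eqI[of _ _ "verts H"]) auto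
    qed
    show "?R \<subseteq> ?L"
    proof safe
      fix S assume S: "S \<subseteq> pverts G" "r \<in> S" "\<forall>v\<in>S. (r, v) \<in> rtrancl_on S (parcs G)"
      then have "connected (with_proj G \<restriction> S)" using connected_induced_iff[OF assms(2)] by simp
      moreover have "induced_subgraph (with_proj G \<restriction> S) (with_proj G)"
        using S(1) induced_induce by auto
      ultimately show "with_proj G \<restriction> S \<in> subtrees G" "r \<in> verts (with_proj G \<restriction> S)"
        using S(2) by (auto simp: subtrees_def)
    qed
  qed
  moreover have "inj_on (\<lambda>S. with_proj G \<restriction> S) ?X"
    by (rule inj_on_inverseI[where g = verts]) simp
  ultimately show ?thesis unfolding num_root_subtrees_def by (simp add: card_image)
qed

text \<open>
  A parent outside of \<open>W\<close> imposes no condition, so \<open>W\<close> may be any forest, its roots being the vertices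
  whose parent is not in \<open>W\<close>.
\<close>

definition parent_closed :: "('a \<Rightarrow> 'a) \<Rightarrow> 'a set \<Rightarrow> 'a set set" where
  "parent_closed par W = {A. A \<subseteq> W \<and> (\<forall>v\<in>A. par v \<in> W \<longrightarrow> par v \<in> A)}"

lemma finite_parent_closed: "finite W \<Longrightarrow> finite (parent_closed par W)"
  by (rule finite_subset[of _ "Pow W"]) (auto simp: parent_closed_def)

text \<open>
  Remove a root \<open>r\<close> of the forest \<open>W\<close>, splitting the rest into the set \<open>D\<close> below \<open>r\<close> and the
  remainder \<open>W'\<close>. Closed sets of \<open>W\<close> arise from a closed set of \<open>W'\<close> together with either nothing or
  \<open>r\<close> and a closed set of \<open>D\<close>. The level function, which increases towards the roots and is bounded
  by \<open>h\<close>, makes \<open>D\<close> a forest with one level less.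
\<close>

lemma dominated_parent_closed:
  fixes lev :: "'a \<Rightarrow> nat"
  assumes "finite W" "\<forall>v\<in>W. lev v < h" "\<forall>v\<in>W. par v \<in> W \<longrightarrow> lev v < lev (par v)"
  shows "dominated h (card W) (card (parent_closed par W))"
  using assms
proof (induction W arbitrary: h rule: finite_psubset_induct)
  case (psubset W)
  show ?case
  proof (cases "W = {}")
    case True
    then have "parent_closed par W = {{}}" by (auto simp: parent_closed_def)
    then show ?thesis using True by (intro dominated_splits[of _ _ "{#}"]) (auto simp: splits_of_size_def)
  next
    case False
    have "Max (lev ` W) \<in> lev ` W" using psubset.hyps False by (intro Max_in) auto
    then obtain r where "r \<in> W" "lev r = Max (lev ` W)" by auto
    then have r: "r \<in> W" "\<forall>v\<in>W. lev v \<le> lev r" using psubset.hyps by auto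
    then have root: "par r \<notin> W" using psubset.prems(2) by (meson leD)
    define R where "R = {(v, par v) |v. v \<in> W \<and> par v \<in> W}"
    define D where "D = {v. (v, r) \<in> R\<^sup>+}"
    define W' where "W' = W - insert r D"
    have less: "lev v < lev r \<and> v \<in> W" if "v \<in> D" for v
    proof -
      have "lev v < lev w \<and> v \<in> W" if "(v, w) \<in> R\<^sup>+" for w
        using that by (induction rule: trancl_induct) (use psubset.prems(2) in \<open>auto simp: R_def dest: less_trans\<close>)
      then show ?thesis using that by (simp add: D_def)
    qed
    then have D: "r \<notin> D" "D \<subseteq> W" by auto
    have par_D: "par v = r \<or> par v \<in> D" if "v \<in> D" for v
    proof -
      from that have "(v, r) \<in> R\<^sup>+" by (simp add: D_def)
      then show ?thesis by (cases rule: converse_tranclE) (auto simp: R_def D_def)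
    qed
    have par_W': "par v \<in> W'" if v: "v \<in> W'" "par v \<in> W" for v
    proof (rule ccontr)
      assume "par v \<notin> W'"
      moreover have "(v, par v) \<in> R" using v by (auto simp: R_def W'_def)
      ultimately have "(v, r) \<in> R\<^sup>+" using v(2) by (auto simp: W'_def D_def intro: trancl_into_trancl2)
      then show False using v by (simp add: W'_def D_def)
    qed
    obtain h' where h': "h = Suc h'" using psubset.prems(1) r(1) by (cases h) auto
    have fin: "finite D" "finite W'" using D(2) psubset.hyps by (auto simp: W'_def intro: finite_subset)
    have "dominated h' (card D) (card (parent_closed par D))"
    proof (rule psubset.IH)
      show "D \<subset> W" using D r(1) by auto
      show "\<forall>v\<in>D. lev v < h'" using less psubset.prems(1) r(1) unfolding h' by fastforce
    qed (use psubset.prems(2) D in auto)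
    from dominated_add_root[OF this]
    have "dominated h (Suc (card D)) (card (parent_closed par D) + 1)" by (simp add: h')
    moreover have "dominated h (card W') (card (parent_closed par W'))"
      by (rule psubset.IH) (use psubset.prems r(1) in \<open>auto simp: W'_def\<close>)
    ultimately have "dominated h (Suc (card D) + card W')
        ((card (parent_closed par D) + 1) * card (parent_closed par W'))"
      by (rule dominated_add)
    moreover have "Suc (card D) + card W' = card W"
    proof -
      have "W = insert r D \<union> W'" "insert r D \<inter> W' = {}" using D r(1) by (auto simp: W'_def)
      then have "card W = card (insert r D) + card W'" using fin by (metis card_Un_disjoint finite_insert)
      then show ?thesis using fin D by simp
    qed
    moreover have "(card (parent_closed par D) + 1) * card (parent_closed par W') \<le> card (parent_closed par W)"
    proof -
      let ?C = "insert {} (insert r ` parent_closed par D)"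
      have "inj_on (insert r) (parent_closed par D)"
        using D(1) by (intro inj_on_inverseI[where g = "\<lambda>A. A - {r}"]) (auto simp: parent_closed_def)
      then have "card ?C = card (parent_closed par D) + 1"
        using finite_parent_closed[OF fin(1)] by (subst card_insert_disjoint) (auto simp: card_image)
      then have "(card (parent_closed par D) + 1) * card (parent_closed par W') = card (?C \<times> parent_closed par W')"
        by (simp add: card_cartesian_product)
      also have "\<dots> \<le> card (parent_closed par W)"
      proof (rule card_inj_on_le[where f = "\<lambda>(X, Y). X \<union> Y"])
        have "insert r D \<inter> W' = {}" by (auto simp: W'_def)
        then show "inj_on (\<lambda>(X, Y). X \<union> Y) (?C \<times> parent_closed par W')"
          by (intro inj_on_inverseI[where g = "\<lambda>Z. (Z \<inter> insert r D, Z \<inter> W')"])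
            (auto simp: parent_closed_def)
        show "(\<lambda>(X, Y). X \<union> Y) ` (?C \<times> parent_closed par W') \<subseteq> parent_closed par W"
        proof (rule image_subsetI)
          fix Z assume "Z \<in> ?C \<times> parent_closed par W'"
          then obtain X Y where Z: "Z = (X, Y)" and X: "X \<in> ?C" and Y: "Y \<in> parent_closed par W'"
            by blast
          have "\<forall>v\<in>Y. par v \<in> W \<longrightarrow> par v \<in> Y" "Y \<subseteq> W"
            using Y par_W' by (auto simp: parent_closed_def W'_def)
          moreover have "\<forall>v\<in>X. par v \<in> W \<longrightarrow> par v \<in> X" "X \<subseteq> W"
            using X par_D D(2) r(1) root by (auto simp: parent_closed_def)
          ultimately show "(\<lambda>(X, Y). X \<union> Y) Z \<in> parent_closed par W"
            unfolding Z by (auto simp: parent_closed_def)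
        qed
      qed (use finite_parent_closed[OF psubset.hyps] in simp)
      finally show ?thesis .
    qed
    ultimately show ?thesis by (metis dominated_mono)
  qed
qed

lemma (in pair_wf_digraph) awalk_relpow: "awalk u p v \<Longrightarrow> (u, v) \<in> parcs G ^^ length p"
proof (induction p arbitrary: u)
  case (Cons e p)
  then have "(u, snd e) \<in> parcs G" "awalk (snd e) p v" by (auto simp: awalk_Cons_iff)
  from relpow_Suc_I2[OF this(1) Cons.IH[OF this(2)]] show ?case by simp
qed (simp add: awalk_def)

text \<open>
  Let every vertex but the root have a neighbour closer to the root as its parent. Then
  every parent-closed set, together with the root, is connected, because from each of its vertices
  the parents lead back to the root.
\<close>

lemma dominated_num_root_subtrees:
  assumes G: "admissible n h G r"
  shows "dominated h (n - 1) (num_root_subtrees G r)"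
proof -
  let ?E = "parcs G"
  have "pair_graph G" and r: "r \<in> pverts G" and n: "card (pverts G) = n"
    and height: "tree_height G r \<le> ereal (real h)"
    using G by (auto simp: admissible_def rooted_tree_def is_tree_def)
  then interpret pair_graph G by simp
  have sym: "sym ?E" using pair_sym_arcs by (simp add: symmetric_def)
  have reach: "\<exists>m\<le>h. (r, v) \<in> ?E ^^ m" if v: "v \<in> pverts G" for v
  proof -
    have "\<mu> (\<lambda>_. 1) r v \<le> tree_height G r"
      unfolding tree_height_def using v pair_finite_verts by (intro Max_ge) auto
    also have "\<dots> < ereal (real h + 1)" using height by (rule le_less_trans) simp
    finally obtain p where p: "awalk r p v" "awalk_cost (\<lambda>_. 1) p < real h + 1"
      by (auto simp: \<mu>_def INF_less_iff)
    have "awalk_cost (\<lambda>_. 1) p = real (length p)" by (induction p) auto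
    with p awalk_relpow[OF p(1)] show ?thesis by (intro exI[of _ "length p"]) auto
  qed
  define d where "d v = (LEAST m. (r, v) \<in> ?E ^^ m)" for v
  have d: "d v \<le> h" "(r, v) \<in> ?E ^^ d v" if "v \<in> pverts G" for v
    using reach[OF that] Least_le[of "\<lambda>m. (r, v) \<in> ?E ^^ m"] LeastI[of "\<lambda>m. (r, v) \<in> ?E ^^ m"]
    unfolding d_def by (auto intro: order_trans)
  have "\<exists>u. (u, v) \<in> ?E \<and> d u < d v" if v: "v \<in> pverts G" "v \<noteq> r" for v
  proof -
    obtain m where m: "d v = Suc m" using d(2)[OF v(1)] v(2) by (cases "d v") auto
    then obtain u where "(r, u) \<in> ?E ^^ m" "(u, v) \<in> ?E" using d(2)[OF v(1)] by auto
    then have "d u \<le> m" unfolding d_def by (intro Least_le)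
    then show ?thesis using m \<open>(u, v) \<in> ?E\<close> by auto
  qed
  then obtain par where par: "\<And>v. v \<in> pverts G \<Longrightarrow> v \<noteq> r \<Longrightarrow> (par v, v) \<in> ?E \<and> d (par v) < d v"
    by metis
  define W where "W = pverts G - {r}"
  \<comment> \<open>Levels have to increase towards the root, hence \<open>h\<close> minus the distance.\<close>
  have "dominated h (card W) (card (parent_closed par W))"
  proof (rule dominated_parent_closed[where lev = "\<lambda>v. h - d v"])
    show "finite W" using pair_finite_verts by (simp add: W_def)
    show "\<forall>v\<in>W. h - d v < h" using par d unfolding W_def by fastforce
    show "\<forall>v\<in>W. par v \<in> W \<longrightarrow> h - d v < h - d (par v)"
    proof (intro ballI impI)
      fix v assume "v \<in> W"
      then have "d (par v) < d v" "d v \<le> h" using par d by (auto simp: W_def)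
      then show "h - d v < h - d (par v)" by simp
    qed
  qed
  moreover have "card W = n - 1" using n r pair_finite_verts by (simp add: W_def)
  moreover have "card (parent_closed par W) \<le> num_root_subtrees G r"
    unfolding num_root_subtrees_eq[OF pair_wf_digraph sym]
  proof (rule card_inj_on_le[where f = "insert r"])
    show "inj_on (insert r) (parent_closed par W)"
      by (rule inj_on_inverseI[where g = "\<lambda>S. S - {r}"]) (auto simp: parent_closed_def W_def)
    show "insert r ` parent_closed par W \<subseteq>
      {S. S \<subseteq> pverts G \<and> r \<in> S \<and> (\<forall>v\<in>S. (r, v) \<in> rtrancl_on S (parcs G))}"
    proof (rule image_subsetI)
      fix A assume A: "A \<in> parent_closed par W"
      have "(r, v) \<in> rtrancl_on (insert r A) ?E" if "v \<in> insert r A" for v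
        using that
      proof (induction "d v" arbitrary: v rule: less_induct)
        case less
        show ?case
        proof (cases "v = r")
          case False
          then have v: "v \<in> A" "v \<in> pverts G" using less.prems A by (auto simp: parent_closed_def W_def)
          note p = par[OF v(2) False]
          have "par v \<in> insert r A"
            using p A v(1) in_arcsD1[of "par v" v] by (auto simp: parent_closed_def W_def)
          with less.hyps p have "(r, par v) \<in> rtrancl_on (insert r A) ?E" by blast
          then show ?thesis using p less.prems by (blast intro: rtrancl_on_into_rtrancl_on)
        qed auto
      qed
      then show "insert r A \<in> {S. S \<subseteq> pverts G \<and> r \<in> S \<and> (\<forall>v\<in>S. (r, v) \<in> rtrancl_on S ?E)}"
        using A r by (auto simp: parent_closed_def W_def)
    qed
    show "finite {S. S \<subseteq> pverts G \<and> r \<in> S \<and> (\<forall>v\<in>S. (r, v) \<in> rtrancl_on S ?E)}"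
      using pair_finite_verts by simp
  qed
  ultimately show ?thesis by (metis dominated_mono)
qed

section \<open>Trees given by a parent function\<close>

text \<open>
  The depth function ensures that following parents ends in the root.
\<close>

locale parent_tree =
  fixes root :: 'a and par :: "'a \<Rightarrow> 'a" and W :: "'a set" and depth :: "'a \<Rightarrow> nat"
  assumes finite_W: "finite W"
    and root_notin: "root \<notin> W"
    and par_in: "v \<in> W \<Longrightarrow> par v \<in> insert root W"
    and depth_root: "depth root = 0"
    and depth_par: "v \<in> W \<Longrightarrow> depth v = Suc (depth (par v))"
begin

definition parent_graph :: "'a pair_pre_digraph" where
  "parent_graph = \<lparr> pverts = insert root W, parcs = (\<lambda>v. (v, par v)) ` W \<union> (\<lambda>v. (par v, v)) ` W \<rparr>"

lemma pverts_graph [simp]: "pverts parent_graph = insert root W"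
  by (simp add: parent_graph_def)

lemma parcs_graph: "(u, v) \<in> parcs parent_graph \<longleftrightarrow> u \<in> W \<and> v = par u \<or> v \<in> W \<and> u = par v"
  by (auto simp: parent_graph_def)

lemma par_neq: "v \<in> W \<Longrightarrow> par v \<noteq> v"
  by (metis depth_par n_not_Suc_n)

lemma sym_graph: "sym (parcs parent_graph)"
  by (auto simp: sym_def parcs_graph)

sublocale G: pair_graph parent_graph
proof unfold_locales
  show "finite (parcs parent_graph)" using finite_W by (simp add: parent_graph_def)
  show "fst e \<in> pverts parent_graph" "snd e \<in> pverts parent_graph" if "e \<in> parcs parent_graph" for e
    using that par_in by (cases e; auto simp: parcs_graph)+
  show "fst e \<noteq> snd e" if "e \<in> parcs parent_graph" for e
    using that par_neq par_neq[symmetric] by (cases e) (auto simp: parcs_graph)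
  show "Digraph.symmetric (with_proj parent_graph)" using sym_graph by (simp add: symmetric_def)
qed (simp add: finite_W)

lemma path_from_root:
  assumes "v \<in> insert root W"
  shows "\<exists>p. G.awalk root p v \<and> length p = depth v"
  using assms
proof (induction "depth v" arbitrary: v rule: less_induct)
  case less
  show ?case
  proof (cases "v = root")
    case True
    then show ?thesis by (intro exI[of _ "[]"]) (simp add: G.awalk_Nil_iff depth_root)
  next
    case False
    then have v: "v \<in> W" using less.prems by simp
    then obtain p where p: "G.awalk root p (par v)" "length p = depth (par v)"
      using less.hyps[of "par v"] depth_par par_in by auto
    have "G.awalk (par v) [(par v, v)] v"
      using v par_in by (simp add: G.awalk_def parcs_graph)
    with p(1) have "G.awalk root (p @ [(par v, v)]) v" by (rule G.awalk_appendI)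
    then show ?thesis using p(2) depth_par[OF v] by (intro exI[of _ "p @ [(par v, v)]"]) simp
  qed
qed

lemma tree_height_le:
  assumes "\<And>v. v \<in> W \<Longrightarrow> depth v \<le> h"
  shows "tree_height parent_graph root \<le> ereal (real h)"
  unfolding tree_height_def
proof (rule Max.boundedI)
  fix x assume "x \<in> G.\<mu> (\<lambda>_. 1) root ` pverts parent_graph"
  then obtain v where v: "v \<in> insert root W" "x = G.\<mu> (\<lambda>_. 1) root v" by auto
  obtain p where p: "G.awalk root p v" "length p = depth v" using path_from_root[OF v(1)] by blast
  have "G.awalk_cost (\<lambda>_. 1) p = real (length p)" by (induction p) auto
  then have "x \<le> ereal (real (depth v))" using G.min_cost_le_walk_cost[OF p(1), of "\<lambda>_. 1"] p(2) v(2) by simp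
  also have "\<dots> \<le> ereal (real h)" using assms v(1) depth_root by auto
  finally show "x \<le> ereal (real h)" .
qed (use finite_W in auto)

lemma pcas_nth:
  assumes "pcas u p w" "Suc i < length p"
  shows "snd (p ! i) = fst (p ! Suc i)"
  using assms
proof (induction p arbitrary: u i)
  case (Cons e p)
  then show ?case by (cases i; cases p) auto
qed simp

text \<open>
  Both neighbours on a cycle of a vertex of maximal depth are its parent, whereas the vertices on
  the cycle are distinct.
\<close>

lemma no_long_cycle: "\<not> (G.cycle p \<and> length p \<ge> 3)"
proof
  assume *: "G.cycle p \<and> length p \<ge> 3"
  then obtain u where walk: "G.awalk u p u" and dist: "distinct (tl (pawalk_verts u p))" and p: "p \<noteq> []"
    by (auto simp: G.cycle_def)
  define l where "l = length p"
  have l: "l \<ge> 3" using * by (simp add: l_def)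
  have cas: "pcas u p u" and arcs: "set p \<subseteq> parcs parent_graph" using walk by (auto simp: G.awalk_def)
  have "tl (pawalk_verts u p) = map snd p" using G.awalk_verts_conv'[OF cas] p by simp
  then have "distinct (map snd p)" using dist by simp
  then have inj: "i = j" if "snd (p ! i) = snd (p ! j)" "i < l" "j < l" for i j
    using that nth_eq_iff_index_eq[of "map snd p" i j] by (simp add: l_def)
  \<comment> \<open>Indices along the cycle are taken cyclically.\<close>
  define nxt where "nxt i = (if Suc i < l then Suc i else 0)" for i
  have nxt: "snd (p ! i) = fst (p ! nxt i)" "nxt i < l" if "i < l" for i
  proof -
    have "snd (last q) = w \<and> fst (hd q) = u" if "pcas u q w" "q \<noteq> []" for u q w
      using that by (induction q arbitrary: u) (auto split: if_splits)
    from this[OF cas p] have "snd (p ! (l - 1)) = fst (p ! 0)"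
      using p by (simp add: l_def last_conv_nth hd_conv_nth)
    moreover have "i = l - 1" if "\<not> Suc i < l" using that \<open>i < l\<close> by simp
    ultimately show "snd (p ! i) = fst (p ! nxt i)" using pcas_nth[OF cas] by (auto simp: nxt_def l_def)
    show "nxt i < l" using l by (simp add: nxt_def)
  qed
  have "Max ((\<lambda>i. depth (snd (p ! i))) ` {..<l}) \<in> (\<lambda>i. depth (snd (p ! i))) ` {..<l}"
    using l by (intro Max_in) (auto simp: lessThan_empty_iff)
  then obtain j where "j < l" "depth (snd (p ! j)) = Max ((\<lambda>i. depth (snd (p ! i))) ` {..<l})" by auto
  then have j: "j < l" "\<And>i. i < l \<Longrightarrow> depth (snd (p ! i)) \<le> depth (snd (p ! j))" by auto
  define i where "i = (if j = 0 then l - 1 else j - 1)"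
  have i: "i < l" "nxt i = j" using l j(1) by (auto simp: i_def nxt_def)
  define v where "v = snd (p ! j)"
  have arc: "p ! m \<in> parcs parent_graph" if "m < l" for m using that arcs by (auto simp: l_def)
  have up: "w = par v" if "(v, w) \<in> parcs parent_graph \<or> (w, v) \<in> parcs parent_graph" "depth w \<le> depth v" for w
    using that depth_par by (fastforce simp: parcs_graph)
  have "snd (p ! i) = par v"
    using arc[OF j(1)] nxt(1)[OF i(1)] j(2)[OF i(1)] unfolding i(2) v_def[symmetric]
    by (intro up) (metis prod.collapse v_def)+
  moreover have "snd (p ! nxt j) = par v"
    using arc[OF nxt(2)[OF j(1)]] nxt(1)[OF j(1)] j(2)[OF nxt(2)[OF j(1)]] unfolding v_def[symmetric]
    by (intro up) (metis prod.collapse)+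
  ultimately have "i = nxt j" using inj i(1) nxt(2)[OF j(1)] by simp
  then show False using l j(1) by (auto simp: i_def nxt_def split: if_splits)
qed

lemma reachable_from_root:
  assumes "v \<in> insert root W"
  shows "(root, v) \<in> rtrancl_on (insert root W) (parcs parent_graph)"
  using assms
proof (induction "depth v" arbitrary: v rule: less_induct)
  case less
  show ?case
  proof (cases "v = root")
    case False
    then have v: "v \<in> W" using less.prems by simp
    then have "(root, par v) \<in> rtrancl_on (insert root W) (parcs parent_graph)"
      using depth_par par_in by (intro less.hyps) auto
    moreover have "(par v, v) \<in> parcs parent_graph" using v by (simp add: parcs_graph)
    ultimately show ?thesis using less.prems by (rule rtrancl_on_into_rtrancl_on)
  qed simp
qed

lemma rooted_tree_graph: "rooted_tree parent_graph root"
proof -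
  have "with_proj parent_graph \<restriction> insert root W = with_proj parent_graph"
    using G.induce_eq_iff_induced[OF G.induced_subgraph_refl] by simp
  then have "connected (with_proj parent_graph)"
    using connected_induced_iff[OF sym_graph, of root "insert root W"] reachable_from_root by simp
  then show ?thesis
    using no_long_cycle G.pair_graph by (auto simp: rooted_tree_def is_tree_def)
qed

text \<open>
  Along a walk from the root inside \<open>S\<close>, every step either goes to a parent or to a child of the
  vertex just visited; hence all ancestors of the vertices reached lie in \<open>S\<close>.
\<close>

lemma num_root_subtrees_le: "num_root_subtrees parent_graph root \<le> card (parent_closed par W)"
  unfolding num_root_subtrees_eq[OF G.pair_wf_digraph sym_graph]
proof (rule card_inj_on_le[where f = "\<lambda>S. S - {root}"])
  let ?X = "{S. S \<subseteq> pverts parent_graph \<and> root \<in> S \<and> (\<forall>v\<in>S. (root, v) \<in> rtrancl_on S (parcs parent_graph))}"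
  show "inj_on (\<lambda>S. S - {root}) ?X" by (rule inj_on_inverseI[where g = "insert root"]) auto
  show "(\<lambda>S. S - {root}) ` ?X \<subseteq> parent_closed par W"
  proof (rule image_subsetI)
    fix S assume S: "S \<in> ?X"
    define R where "R = {(v, par v) |v. v \<in> W}"
    \<comment> \<open>The statement for all ancestors \<open>a\<close> of \<open>v\<close> is what the induction along the walk needs.\<close>
    have anc: "a \<in> S" if "(root, v) \<in> rtrancl_on S (parcs parent_graph)" "(v, a) \<in> R\<^sup>*" for v a
      using that
    proof (induction arbitrary: a rule: rtrancl_on_induct)
      case base
      from \<open>(root, a) \<in> R\<^sup>*\<close> show ?case
        by (cases rule: converse_rtranclE) (use S root_notin in \<open>auto simp: R_def\<close>)
    next
      case (step y z)
      from \<open>(y, z) \<in> parcs parent_graph\<close> consider "y \<in> W" "z = par y" | "z \<in> W" "y = par z"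
        by (auto simp: parcs_graph)
      then show ?case
      proof cases
        case 1
        then have "(y, z) \<in> R" by (auto simp: R_def)
        then show ?thesis using step by (blast intro: converse_rtrancl_into_rtrancl)
      next
        case 2
        from \<open>(z, a) \<in> R\<^sup>*\<close> show ?thesis
          by (cases rule: converse_rtranclE) (use 2 step in \<open>auto simp: R_def\<close>)
      qed
    qed
    have "par v \<in> S - {root}" if "v \<in> S - {root}" "par v \<in> W" for v
    proof -
      have "(v, par v) \<in> R" using that S by (auto simp: R_def)
      then show ?thesis using anc[of v "par v"] that S root_notin by auto
    qed
    then show "S - {root} \<in> parent_closed par W" using S by (auto simp: parent_closed_def)
  qed
qed (use finite_W finite_parent_closed in auto)

lemma children_graph: "children parent_graph root = {v \<in> W. par v = root}"
  using root_notin by (auto simp: children_def parcs_graph)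

text \<open>
  A path from the root through its child \<open>v\<close> has used up the root, and no other arc leaves \<open>D\<close>. In
  the other direction the path following the parents is simple because depths increase along it.
\<close>

lemma descendants_graph:
  assumes v: "v \<in> W" "par v = root"
    and D: "v \<in> D" "D \<subseteq> W" "\<And>w. w \<in> W \<Longrightarrow> w \<noteq> v \<Longrightarrow> par w \<in> D \<longleftrightarrow> w \<in> D"
  shows "descendants parent_graph root v = D"
proof
  show "descendants parent_graph root v \<subseteq> D"
  proof
    fix w assume "w \<in> descendants parent_graph root v"
    then obtain p where p: "vwalk p (with_proj parent_graph)" "distinct p" "hd p = root" "last p = w" "v \<in> set p"
      by (auto simp: descendants_def vpath_def)
    have stay: "last (y # q) \<in> D" if "vwalk (y # q) (with_proj parent_graph)" "root \<notin> set (y # q)" "y \<in> D" for y q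
      using that
    proof (induction q arbitrary: y)
      case (Cons z q)
      then have arc: "(y, z) \<in> parcs parent_graph" and z: "vwalk (z # q) (with_proj parent_graph)" "z \<noteq> root"
        by (auto simp: vwalk_def)
      have "z \<in> D" using arc z(2) v D Cons.prems(3) unfolding parcs_graph by metis
      with Cons.IH[OF z(1)] Cons.prems(2) show ?case by simp
    qed simp
    obtain p1 p2 where p12: "p = p1 @ v # p2" using p(5) by (auto simp: in_set_conv_decomp)
    have "p1 \<noteq> []" using p12 p(3) v(1) root_notin by auto
    then have "root \<in> set p1" using p(3) p12 by (metis hd_append2 hd_in_set)
    then have "root \<notin> set (v # p2)" using p(2) p12 by auto
    moreover have "vwalk (v # p2) (with_proj parent_graph)" using vwalkI_append_r[of "v # p2" p1] p(1) p12 by simp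
    ultimately show "w \<in> D" using stay[of v p2] D(1) p(4) p12 by simp
  qed
  show "D \<subseteq> descendants parent_graph root v"
  proof
    have "\<exists>p. vpath p (with_proj parent_graph) \<and> hd p = root \<and> last p = w \<and> (\<forall>y\<in>set p. depth y \<le> depth w)
        \<and> (w \<in> D \<longrightarrow> v \<in> set p)" if "w \<in> insert root W" for w
      using that
    proof (induction "depth w" arbitrary: w rule: less_induct)
      case less
      show ?case
      proof (cases "w = root")
        case True
        then show ?thesis using D(2) root_notin
          by (intro exI[of _ "[root]"]) (auto simp: vpath_def)
      next
        case False
        then have w: "w \<in> W" using less.prems by simp
        then obtain p where p: "vpath p (with_proj parent_graph)" "hd p = root" "last p = par w"
          "\<forall>y\<in>set p. depth y \<le> depth (par w)" "par w \<in> D \<Longrightarrow> v \<in> set p"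
          using less.hyps[of "par w"] depth_par[OF w] par_in[OF w] by auto
        have ne: "p \<noteq> []" using p(1) by (auto simp: vpath_def vwalk_def)
        have "w \<notin> set p" using p(4) depth_par[OF w] by force
        moreover have "vwalk (p @ [w]) (with_proj parent_graph)"
          using p(1,3) ne w by (auto simp: vpath_def vwalk_def vwalk_arcs_append parcs_graph)
        ultimately have "vpath (p @ [w]) (with_proj parent_graph)" using p(1) by (auto simp: vpath_def)
        moreover have "\<forall>y\<in>set (p @ [w]). depth y \<le> depth w" using p(4) depth_par[OF w] by auto
        moreover have "w \<in> D \<Longrightarrow> v \<in> set (p @ [w])" using p(5) D(3)[OF w] by auto
        ultimately show ?thesis using p(2) ne by (intro exI[of _ "p @ [w]"]) auto
      qed
    qed
    then show "w \<in> descendants parent_graph root v" if "w \<in> D" for w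
      using that D(2) unfolding descendants_def by blast
  qed
qed

end

section \<open>Trees whose branches are splits\<close>

text \<open>
  Parents and depths in \<^const>\<open>split_graph\<close>, where the second leg starts with \<open>h + 1\<close> attached to
  the fork \<open>h - f\<close>. The root \<open>1\<close> gets the parent \<open>0\<close>, which is not a vertex.
\<close>

definition split_parent :: "nat \<Rightarrow> nat \<Rightarrow> nat \<Rightarrow> nat" where
  "split_parent h f x = (if x = h + 1 then h - f else x - 1)"

definition split_depth :: "nat \<Rightarrow> nat \<Rightarrow> nat \<Rightarrow> nat" where
  "split_depth h f x = (if x \<le> h then x else x - f)"

lemma parcs_split_graph:
  assumes "f < h"
  shows "(x, y) \<in> parcs (split_graph h f) \<longleftrightarrow>
    x \<in> {2..h + f} \<and> y = split_parent h f x \<or> y \<in> {2..h + f} \<and> x = split_parent h f y"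
proof -
  have "(x, y) \<in> split_edges h f \<union> (split_edges h f)\<inverse> \<longleftrightarrow>
      (x \<in> {2..h + f} \<and> y = split_parent h f x) \<or> (y \<in> {2..h + f} \<and> x = split_parent h f y)"
    (is "?L \<longleftrightarrow> ?R")
  proof
    have edge: "(y \<in> {2..h + f} \<and> x = split_parent h f y) \<or> (x \<in> {2..h + f} \<and> y = split_parent h f x)"
      if "(x, y) \<in> split_edges h f" for x y
      using that assms by (auto simp: split_edges_def split_parent_def split: if_splits)
    show ?R if ?L using that edge[of x y] edge[of y x] by blast
  next
    have edge: "(split_parent h f x, x) \<in> split_edges h f \<or> (x, split_parent h f x) \<in> split_edges h f"
      if x: "x \<in> {2..h + f}" for x
    proof -
      have "x \<le> h \<or> x = h + 1 \<and> f > 0 \<or> x \<ge> h + 2" using x by simp arith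
      then consider "x \<le> h" | "x = h + 1" "f > 0" | "x \<ge> h + 2" by blast
      then show ?thesis
      proof cases
        case 1
        then show ?thesis using x by (auto simp: split_edges_def split_parent_def)
      next
        case 2
        then show ?thesis by (auto simp: split_edges_def split_parent_def)
      next
        case 3
        then have "x - 1 = h + (x - h - 1)" "x = h + (x - h - 1 + 1)" by auto
        then show ?thesis using x 3 unfolding split_edges_def split_parent_def
          by (intro disjI1 UnI1 UnI2 CollectI exI[of _ "x - h - 1"]) auto
      qed
    qed
    show ?L if ?R using that edge[of x] edge[of y] by blast
  qed
  then show ?thesis by (simp add: split_graph_def)
qed

lemma initial_segment:
  fixes a n :: nat
  assumes "A \<subseteq> {a + 1..a + n}" "\<And>x. x \<in> A \<Longrightarrow> a + 1 < x \<Longrightarrow> x - 1 \<in> A"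
  obtains q where "q \<le> n" "A = {a + 1..a + q}"
proof -
  have "\<exists>q\<le>n. A = {a + 1..a + q}"
    using assms(1)
  proof (induction n)
    case (Suc n)
    show ?case
    proof (cases "a + Suc n \<in> A")
      case True
      have "a + 1 + j \<in> A" if "j \<le> n" for j
        using that
      proof (induction rule: inc_induct)
        case (step j)
        then show ?case using assms(2)[of "a + 1 + Suc j"] by simp
      qed (use True in simp)
      then have "x \<in> A" if "x \<in> {a + 1..a + Suc n}" for x
        using that by (metis Suc_eq_plus1 add.assoc add_le_cancel_left atLeastAtMost_iff le_iff_add Suc_le_mono add.commute)
      then show ?thesis using Suc.prems by blast
    next
      case False
      then have "A \<subseteq> {a + 1..a + n}" using Suc.prems by (force simp: le_Suc_eq)
      then show ?thesis using Suc.IH le_SucI by blast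
    qed
  qed simp
  then show thesis using that by blast
qed

text \<open>
  A closed set consists of an initial segment of the spine and an initial segment of the second
  leg, and the latter is empty unless the fork is included.
\<close>

lemma card_parent_closed_split:
  assumes f: "f < h"
  shows "card (parent_closed (split_parent h f) {1..h + f}) \<le> split_count h f"
proof -
  let ?I = "{0..<h - f} \<times> {0} \<union> {h - f..h} \<times> {0..f}"
  have "parent_closed (split_parent h f) {1..h + f} \<subseteq> (\<lambda>(p, q). {0 + 1..0 + p} \<union> {h + 1..h + q}) ` ?I"
  proof
    fix A assume A: "A \<in> parent_closed (split_parent h f) {1..h + f}"
    then have sub: "A \<subseteq> {1..h + f}" by (simp add: parent_closed_def)
    have closed: "split_parent h f x \<in> A" if "x \<in> A" "split_parent h f x \<in> {1..h + f}" for x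
      using A that by (simp add: parent_closed_def)
    have pred: "x - 1 \<in> A" if "x \<in> A" "1 < x" "x \<noteq> h + 1" for x
      using closed[of x] that subsetD[OF sub that(1)] by (cases x) (auto simp: split_parent_def)
    obtain p where p: "p \<le> h" "A \<inter> {1..h} = {0 + 1..0 + p}"
      by (rule initial_segment[of "A \<inter> {1..h}" 0 h]) (use pred in auto)
    obtain q where q: "q \<le> f" "A \<inter> {h + 1..h + f} = {h + 1..h + q}"
    proof (rule initial_segment[of "A \<inter> {h + 1..h + f}" h f])
      show "x - 1 \<in> A \<inter> {h + 1..h + f}" if "x \<in> A \<inter> {h + 1..h + f}" "h + 1 < x" for x
        using pred[of x] that by auto
    qed auto
    have "h - f \<le> p" if "q > 0"
    proof -
      have "h + 1 \<in> A \<inter> {h + 1..h + f}" unfolding q using that by simp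
      then have "h - f \<in> A \<inter> {1..h}" using closed[of "h + 1"] f by (auto simp: split_parent_def Suc_le_eq)
      then show ?thesis unfolding p by simp
    qed
    then have "(p, q) \<in> ?I" using p(1) q(1) by auto
    moreover have "A = (A \<inter> {1..h}) \<union> (A \<inter> {h + 1..h + f})" using sub by auto
    then have "A = {0 + 1..0 + p} \<union> {h + 1..h + q}" unfolding p q .
    ultimately show "A \<in> (\<lambda>(p, q). {0 + 1..0 + p} \<union> {h + 1..h + q}) ` ?I"
      by (intro image_eqI[of _ _ "(p, q)"]) simp_all
  qed
  then have "card (parent_closed (split_parent h f) {1..h + f}) \<le> card ?I"
    by (intro surj_card_le) auto
  also have "\<dots> = (h - f) + (f + 1) * (f + 1)"
    using f by (subst card_Un_disjoint) (auto simp: card_cartesian_product)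
  also have "\<dots> = split_count h f" using f by (simp add: split_count_def)
  finally show ?thesis .
qed

text \<open>
  The tree with branches the \<open>k i\<close>-splits: vertex \<open>x\<close> of the \<open>i\<close>-th split is encoded by the pair
  \<open>(i, x)\<close>, and the pair \<open>(0, 0)\<close> is the root.
\<close>

locale split_tree =
  fixes h r :: nat and k :: "nat \<Rightarrow> nat"
  assumes k_less: "i \<in> {1..r} \<Longrightarrow> k i < h"
begin

definition root :: nat where
  "root = prod_encode (0, 0)"

definition par :: "nat \<Rightarrow> nat" where
  "par v = (case prod_decode v of (i, x) \<Rightarrow> if x = 1 then root else prod_encode (i, split_parent h (k i) x))"

definition depth :: "nat \<Rightarrow> nat" where
  "depth v = (case prod_decode v of (i, x) \<Rightarrow> split_depth h (k i) x)"

definition branch_verts :: "nat \<Rightarrow> nat set" where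
  "branch_verts i = (\<lambda>x. prod_encode (i, x)) ` {1..h + k i}"

definition W :: "nat set" where
  "W = (\<Union>i\<in>{1..r}. branch_verts i)"

lemma W_iff: "prod_encode (i, x) \<in> W \<longleftrightarrow> i \<in> {1..r} \<and> x \<in> {1..h + k i}"
  by (auto simp: W_def branch_verts_def image_iff)

lemma W_cases:
  assumes "v \<in> W"
  obtains i x where "v = prod_encode (i, x)" "i \<in> {1..r}" "x \<in> {1..h + k i}" "k i < h"
  using assms k_less by (auto simp: W_def branch_verts_def)

lemma par_encode: "par (prod_encode (i, x)) = (if x = 1 then root else prod_encode (i, split_parent h (k i) x))"
  by (simp add: par_def)

lemma depth_encode: "depth (prod_encode (i, x)) = split_depth h (k i) x"
  by (simp add: depth_def)

lemma split_parent_in: "i \<in> {1..r} \<Longrightarrow> x \<in> {1..h + k i} \<Longrightarrow> x \<noteq> 1 \<Longrightarrow> split_parent h (k i) x \<in> {1..h + k i}"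
  using k_less[of i] by (auto simp: split_parent_def)

sublocale parent_tree root par W depth
proof
  show "finite W" by (simp add: W_def branch_verts_def)
  show "root \<notin> W" by (auto simp: root_def W_iff)
  show "depth root = 0" by (simp add: root_def depth_encode split_depth_def)
  show "par v \<in> insert root W" if "v \<in> W" for v
    using that by (cases rule: W_cases) (use split_parent_in in \<open>auto simp: par_encode W_iff\<close>)
  show "depth v = Suc (depth (par v))" if "v \<in> W" for v
    using that by (cases rule: W_cases)
      (auto simp: par_encode depth_encode split_depth_def split_parent_def root_def split: if_splits)
qed

lemma card_W: "card W = (\<Sum>i\<in>{1..r}. h + k i)"
proof -
  have "card (branch_verts i) = h + k i" for i
    unfolding branch_verts_def by (subst card_image) (auto intro: inj_onI)
  then show ?thesis unfolding W_def by (subst card_UN_disjoint) (auto simp: branch_verts_def)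
qed

lemma depth_le: "v \<in> W \<Longrightarrow> depth v \<le> h"
  by (cases rule: W_cases) (auto simp: depth_encode split_depth_def)

text \<open>
  A closed set is determined by its traces on the branches, which are closed.
\<close>

lemma card_parent_closed_le: "card (parent_closed par W) \<le> (\<Prod>i\<in>{1..r}. split_count h (k i))"
proof -
  let ?C = "\<lambda>i. parent_closed (split_parent h (k i)) {1..h + k i}"
  define g where "g A = (\<lambda>i\<in>{1..r}. {x. prod_encode (i, x) \<in> A})" for A
  have "card (parent_closed par W) \<le> card (Pi\<^sub>E {1..r} ?C)"
  proof (rule card_inj_on_le[where f = g])
    show "inj_on g (parent_closed par W)"
    proof (rule inj_onI)
      fix A B assume A: "A \<in> parent_closed par W" and B: "B \<in> parent_closed par W" and eq: "g A = g B"
      have "v \<in> A \<longleftrightarrow> v \<in> B" if v: "v \<in> W" for v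
        using v
      proof (cases rule: W_cases)
        case (1 i x)
        then show ?thesis using fun_cong[OF eq, of i] by (auto simp: g_def)
      qed
      then show "A = B" using A B by (auto simp: parent_closed_def)
    qed
    show "g ` parent_closed par W \<subseteq> Pi\<^sub>E {1..r} ?C"
    proof (rule image_subsetI)
      fix A assume A: "A \<in> parent_closed par W"
      have "{x. prod_encode (i, x) \<in> A} \<in> ?C i" if i: "i \<in> {1..r}" for i
      proof -
        have "split_parent h (k i) x \<in> {x. prod_encode (i, x) \<in> A}"
          if "prod_encode (i, x) \<in> A" "split_parent h (k i) x \<in> {1..h + k i}" for x
        proof -
          have "x \<noteq> 1" using that(2) k_less[OF i] by (auto simp: split_parent_def)
          then show ?thesis using that A i by (auto simp: parent_closed_def par_encode W_iff)
        qed
        moreover have "{x. prod_encode (i, x) \<in> A} \<subseteq> {1..h + k i}"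
          using A by (auto simp: parent_closed_def W_iff dest!: subsetD)
        ultimately show ?thesis by (simp add: parent_closed_def)
      qed
      then show "g A \<in> Pi\<^sub>E {1..r} ?C" by (auto simp: g_def)
    qed
    show "finite (Pi\<^sub>E {1..r} ?C)" by (intro finite_PiE finite_parent_closed) auto
  qed
  also have "\<dots> = (\<Prod>i\<in>{1..r}. card (?C i))" by (simp add: card_PiE)
  also have "\<dots> \<le> (\<Prod>i\<in>{1..r}. split_count h (k i))"
    using k_less card_parent_closed_split by (intro prod_mono) auto
  finally show ?thesis .
qed

lemma admissible_split_tree: "admissible (Suc (\<Sum>i\<in>{1..r}. h + k i)) h parent_graph root"
  unfolding admissible_def using rooted_tree_graph tree_height_le depth_le finite_W root_notin
  by (auto simp: card_W)

lemma num_root_subtrees_split_tree: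
  "num_root_subtrees parent_graph root \<le> (\<Prod>i\<in>{1..r}. split_count h (k i))"
  using num_root_subtrees_le card_parent_closed_le by (rule le_trans)

lemma children_split_tree: "bij_betw (\<lambda>i. prod_encode (i, 1)) {1..r} (children parent_graph root)"
proof -
  have "children parent_graph root = (\<lambda>i. prod_encode (i, 1)) ` {1..r}"
  proof
    show "children parent_graph root \<subseteq> (\<lambda>i. prod_encode (i, 1)) ` {1..r}"
    proof
      fix v assume "v \<in> children parent_graph root"
      then have "v \<in> W" "par v = root" by (auto simp: children_graph)
      then show "v \<in> (\<lambda>i. prod_encode (i, 1)) ` {1..r}"
        by (cases rule: W_cases) (auto simp: par_encode root_def split: if_splits)
    qed
    show "(\<lambda>i. prod_encode (i, 1)) ` {1..r} \<subseteq> children parent_graph root"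
      using k_less by (fastforce simp: children_graph par_encode W_iff)
  qed
  then show ?thesis by (auto simp: bij_betw_def intro: inj_onI)
qed

lemma descendants_split_tree:
  assumes i: "i \<in> {1..r}"
  shows "descendants parent_graph root (prod_encode (i, 1)) = branch_verts i"
proof (rule descendants_graph)
  show "prod_encode (i, 1) \<in> W" "prod_encode (i, 1) \<in> branch_verts i"
    using k_less[OF i] i by (auto simp: W_iff branch_verts_def)
  show "par (prod_encode (i, 1)) = root" by (simp add: par_encode)
  show "branch_verts i \<subseteq> W" using i by (auto simp: W_def)
  show "par w \<in> branch_verts i \<longleftrightarrow> w \<in> branch_verts i" if w: "w \<in> W" "w \<noteq> prod_encode (i, 1)" for w
    using w(1)
  proof (cases rule: W_cases)
    case (1 j x)
    have "root \<notin> branch_verts i" using root_notin i by (auto simp: W_def)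
    then show ?thesis using 1 w(2) i split_parent_in[of j x]
      by (auto simp: par_encode branch_verts_def)
  qed
qed

lemma branch_split_tree:
  assumes i: "i \<in> {1..r}"
  shows "is_split h (k i) (branch parent_graph root (prod_encode (i, 1))) (prod_encode (i, 1))"
proof -
  define e where "e = (\<lambda>x. prod_encode (i, x))"
  define c where "c = snd \<circ> prod_decode"
  have ce: "c (e x) = x" for x by (simp add: c_def e_def)
  let ?B = "branch parent_graph root (prod_encode (i, 1))"
  let ?S = "with_proj (split_graph h (k i))"
  let ?\<phi> = "\<lparr>iso_verts = c, iso_arcs = map_prod c c, iso_head = snd, iso_tail = fst\<rparr>"
  have B: "?B = with_proj parent_graph \<restriction> branch_verts i"
    unfolding branch_def descendants_split_tree[OF i] ..
  have verts: "verts ?B = e ` {1..h + k i}" unfolding B branch_verts_def e_def by simp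
  have arcs: "arcs ?B = map_prod e e ` parcs (split_graph h (k i))"
  proof -
    have arc: "(e x, e y) \<in> parcs parent_graph \<longleftrightarrow> (x, y) \<in> parcs (split_graph h (k i))"
      if "x \<in> {1..h + k i}" "y \<in> {1..h + k i}" for x y
      using that i unfolding parcs_graph parcs_split_graph[OF k_less[OF i]]
      by (auto simp: e_def par_encode W_iff root_def)
    have in_range: "x \<in> {1..h + k i}" "y \<in> {1..h + k i}" if "(x, y) \<in> parcs (split_graph h (k i))" for x y
      using that split_parent_in[OF i] unfolding parcs_split_graph[OF k_less[OF i]] by force+
    have "arcs ?B = {a \<in> parcs parent_graph. fst a \<in> e ` {1..h + k i} \<and> snd a \<in> e ` {1..h + k i}}"
      unfolding B branch_verts_def e_def by simp
    also have "\<dots> = map_prod e e ` parcs (split_graph h (k i))"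
    proof
      show "{a \<in> parcs parent_graph. fst a \<in> e ` {1..h + k i} \<and> snd a \<in> e ` {1..h + k i}}
          \<subseteq> map_prod e e ` parcs (split_graph h (k i))"
        using arc by (force simp: map_prod_def)
      show "map_prod e e ` parcs (split_graph h (k i)) \<subseteq>
          {a \<in> parcs parent_graph. fst a \<in> e ` {1..h + k i} \<and> snd a \<in> e ` {1..h + k i}}"
        using arc in_range by auto
    qed
    finally show ?thesis .
  qed
  have ends: "tail ?B = fst" "head ?B = snd" unfolding B by simp_all
  have "wf_digraph ?B" unfolding B by (rule G.wellformed_induce_subgraph)
  moreover have "inj_on c (e ` {1..h + k i})" by (auto simp: inj_on_def ce)
  moreover have "inj_on (map_prod c c) (map_prod e e ` parcs (split_graph h (k i)))"
    by (auto simp: inj_on_def ce)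
  ultimately have "pre_digraph.digraph_isomorphism ?B ?\<phi>"
    unfolding pre_digraph.digraph_isomorphism_def verts arcs ends by auto
  moreover have "?S = app_iso ?\<phi> ?B"
    unfolding app_iso_def verts arcs
    by (simp add: with_proj_def image_image map_prod_def ce split_beta split_graph_def)
  ultimately have "rooted_iso ?B (e 1) ?S 1"
    unfolding rooted_iso_def by (intro exI[of _ ?\<phi>]) (simp add: ce)
  then show ?thesis using k_less[OF i] by (simp add: is_split_def e_def)
qed

end

section \<open>Optimal trees\<close>

theorem theorem5p1:
  fixes n h :: nat
  assumes "n > 0" and "h > 0" and "h < n"
  shows "\<exists>(T :: nat pair_pre_digraph) (root :: nat) (r :: nat) (v :: nat \<Rightarrow> nat) (k :: nat \<Rightarrow> nat).
    optimal n h T root \<and>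
    bij_betw v {1..r} (children T root) \<and>
    (\<forall>i\<in>{1..r}. is_split h (k i) (branch T root (v i)) (v i)) \<and>
    (\<forall>i j. 1 \<le> i \<and> i \<le> j \<and> j \<le> r \<longrightarrow> k j \<le> k i) \<and>
    (type_paths r k \<or> type_one_large n h r k \<or> type_even n h r k)"
proof -
  define m where "m = n - 1"
  have m: "n = Suc m" "h \<le> m" using assms by (auto simp: m_def)
  obtain F where F: "minimal_splits h m F" using minimal_splits_exists[OF assms(2) m(2)] .
  then obtain r k where k: "F = image_mset k (mset_set {1..r})"
    "\<forall>i j. 1 \<le> i \<and> i \<le> j \<and> j \<le> r \<longrightarrow> k j \<le> k i"
    "type_one_large (Suc m) h r k \<or> type_even (Suc m) h r k"
    using minimal_splits_type[OF _ assms(2) m(2)] by metis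
  have size: "(\<forall>i\<in>{1..r}. k i < h) \<and> (\<Sum>i\<in>{1..r}. h + k i) = m"
    using F unfolding minimal_splits_def splits_of_size_def k(1)
    by (simp add: multiset.map_comp comp_def flip: sum_unfold_sum_mset)
  then interpret split_tree h r k by unfold_locales auto
  have "num_root_subtrees parent_graph root \<le> num_root_subtrees G' r'" if "admissible n h G' r'"
    for G' :: "nat pair_pre_digraph" and r'
  proof -
    have "num_root_subtrees parent_graph root \<le> (\<Prod>f\<in>#F. split_count h f)"
      using num_root_subtrees_split_tree
      by (simp add: k(1) multiset.map_comp comp_def flip: prod_unfold_prod_mset)
    also have "\<dots> \<le> num_root_subtrees G' r'"
      using minimal_splits_dominated[OF F _ m(2)] dominated_num_root_subtrees[OF that] by (simp add: m_def)
    finally show ?thesis .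
  qed
  then have "optimal n h parent_graph root"
    using admissible_split_tree size by (auto simp: optimal_def m(1))
  then show ?thesis
    using children_split_tree branch_split_tree k(2,3) unfolding m(1) by blast
qed

end
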